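(* Let $U\subseteq M$ be open, $f:U\to\mathbb C$ an eigenfunction of the Laplace-Beltrami operator, $l\in\mathbb{C}^\times$. Let $m_1,\dots,m_s,t_1,\dots,t_k\in\mathbb Z_+$, let $0\le k\le r$, and let $i_1,\dots,i_s,j_1,\dots,j_r\in\{+,-\}$ be such that each of the two sequences $(i_1,\dots,i_s)$ and $(j_1,\dots,j_r)$ contains as many $+$ as $-$. Put $$v=h_{i_1}(-m_1)\cdots h_{i_s}(-m_s)\mathbf 1\in V(l,\mathbf 1),\qquad w=h_{j_1}(-t_1)\cdots h_{j_k}(-t_k)h_{j_{k+1}}(0)\cdots h_{j_r}(0)f\in V_U(l,f),$$ $n=m_1+\cdots+m_s+t_1+\cdots+t_k-1$. Then $v_nw$ is the lowest weight component of $Y(v,x)w$ (the one of the same weight as $f$). If $s<k$ then $v_nw=0$; if $s\ge k$ then $$v_nw=\sum_{1\le c_k<\cdots<c_1\le s}\ \sum_{\sigma\in S_k}\ \prod_{\substack{1\le q\le s\\ q\ne c_1,\dots,c_k}}(-1)^{m_q-1}\cdot\prod_{q=1}^k\frac{(-t_{\sigma(q)}-1)\cdots(-t_{\sigma(q)}-m_{c_q}+1)}{(m_{c_q}-1)!}\cdot\prod_{q=1}^kt_{\sigma(q)}\,l\,\langle i_{c_q},j_{\sigma(q)}\rangle\cdot h_{i_1}(0)\cdots\widehat{h_{i_{c_k}}(0)}\cdots\widehat{h_{i_{c_1}}(0)}\cdots h_{i_s}(0)\,h_{j_{k+1}}(0)\cdots h_{j_r}(0)f,$$ where hats denote omitted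 factors, $\langle+,+\rangle=\langle-,-\rangle=0$ and $\langle+,-\rangle=\langle-,+\rangle=2$.
   Context: Geometry: $M$ is a two-dimensional, connected, complete, orientable Riemannian manifold of constant sectional curvature $K\neq0$; $E=\mathbb C\otimes_{\mathbb R}TM$ with complex-linearly extended Levi-Civita connection $\nabla$ and complex-bilinearly extended metric $(\cdot,\cdot)$. Fix $p\in M$, an orthonormal basis $e_1,e_2$ of $T_pM$, and $h_\pm=e_1\mp\sqrt{-1}e_2\in E_p$, so $(h_\pm,h_\pm)=0$, $(h_+,h_-)=2$. $\Pi(T(E))$ is the algebra of parallel sections of $T(E)=\bigoplus_kE^{\otimes k}$, identified by evaluation at $p$ with the subalgebra of the tensor algebra $T(E_p)$ spanned by the words $h_{i_1}\otimes\cdots\otimes h_{i_k}$ with as many $+$ as $-$. $X\in\Pi(E^{\otimes k})$ acts on $C^\infty(U)$ (complex valued) by $g\mapsto(\nabla^kg)(X)$, with $(\nabla^kg)(Z_1,\dots,Z_k)=(\nabla_{Z_1}(\nabla^{k-1}g))(Z_2,\dots,Z_k)$. An eigenfunction is a nonzero smooth $f$ with $-\Delta f=\lambda f$, $\lambda\in\mathbb C$. Modes: for a left $T(E_p)$-module $S$ put $F(S)=T(\widehat E_{p,-})\otimes S$, $\widehat E_{p,-}=E_p\otimes t^{-1}\mathbb C[t^{-1}]$. For $a\in E_p$: $a(-m)$ ($m>0$) is left multiplication by $a\otimes t^{-m}$; $a(0)$ acts as $1\otimes a$ through $S$; $a(m)$ ($m>0$) kills $1\otimes S$ and satisfies $a(m)b(-n)=b(-n)a(m)+m(a,b)\delta_{m,n}l$.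 Set $a(x)=\sum_na(n)x^{-n-1}$; normal ordering ${:}\ {:}$ places negative modes first, then positive modes, then zero modes, preserving relative order in each group. $V=V(l,\mathbf 1)$ has basis the words $v=h_{i_1}(-m_1)\cdots h_{i_s}(-m_s)\mathbf 1$ with $m_j\in\mathbb Z_+$ and as many $+$ as $-$, of weight $\sum_jm_j$; it acts on $F(S)$ by $Y(v,x)={:}\prod_{j=1}^s\frac1{(m_j-1)!}\frac{d^{m_j-1}}{dx^{m_j-1}}h_{i_j}(x){:}=\sum_nv_nx^{-n-1}$ (product in the order $j=1,\dots,s$). $V_U(l,f)$ is the span of all $v_n f$ inside $F(S)$ with $S=T(E_p)\otimes_{\Pi(T(E))}C^\infty(U)$, where $f$ stands for $1\otimes(1\otimes f)$; it is graded by $\mathrm{wt}\,f=0$, each factor $h_\pm(-t)$ ($t>0$) adding $t$ and each $h_\pm(0)$ adding $0$. *)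

theory Defs
  imports "HOL-Analysis.Analysis" "HOL-Library.Poly_Mapping"
begin

section \<open>Smooth maps on open subsets of the plane\<close>

definition pdiff :: "2 \<Rightarrow> (real^2 \<Rightarrow> 'b::real_normed_vector) \<Rightarrow> real^2 \<Rightarrow> 'b" where
  "pdiff i F x = frechet_derivative F (at x) (axis i 1)"

fun Ck_on :: "nat \<Rightarrow> (real^2) set \<Rightarrow> (real^2 \<Rightarrow> 'b::real_normed_vector) \<Rightarrow> bool" where
  "Ck_on 0 W F \<longleftrightarrow> continuous_on W F"
| "Ck_on (Suc k) W F \<longleftrightarrow> (\<forall>x\<in>W. F differentiable (at x)) \<and> (\<forall>i. Ck_on k W (pdiff i F))"

text \<open>Only used for open \<open>W\<close>.\<close>

definition smooth_on :: "(real^2) set \<Rightarrow> (real^2 \<Rightarrow> 'b::real_normed_vector) \<Rightarrow> bool" where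
  "smooth_on W F \<longleftrightarrow> (\<forall>k. Ck_on k W F)"


section \<open>Riemannian surfaces\<close>

text \<open>A chart is its domain together with its coordinate map; the coordinate map is only
  meaningful on the domain.  The underlying set of a surface is the whole type.  The metric is
  given by its component matrix in every chart, as a function of the point of the surface (not
  of its coordinates); other tensor fields are represented likewise.\<close>

type_synonym 'm chart = "'m set \<times> ('m \<Rightarrow> real^2)"

record 'm surface =
  charts :: "'m chart set"
  metric :: "'m chart \<Rightarrow> 'm \<Rightarrow> real^2^2"

definition local_rep :: "'m chart \<Rightarrow> ('m \<Rightarrow> 'b) \<Rightarrow> real^2 \<Rightarrow> 'b" where
  "local_rep c F = F \<circ> inv_into (fst c) (snd c)"

definition cpdiff :: "'m chart \<Rightarrow> 2 \<Rightarrow> ('m \<Rightarrow> 'b::real_normed_vector) \<Rightarrow> 'm \<Rightarrow> 'b" where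
  "cpdiff c i F q = pdiff i (local_rep c F) (snd c q)"

definition topological_chart :: "('m::topological_space) chart \<Rightarrow> bool" where
  "topological_chart c \<longleftrightarrow> open (fst c) \<and> open (snd c ` fst c) \<and>
     homeomorphism (fst c) (snd c ` fst c) (snd c) (inv_into (fst c) (snd c))"

definition smooth_transition :: "'m chart \<Rightarrow> 'm chart \<Rightarrow> bool" where
  "smooth_transition c d \<longleftrightarrow> smooth_on (snd c ` (fst c \<inter> fst d)) (local_rep c (snd d))"

text \<open>The row index belongs to \<open>d\<close>, the column index to \<open>c\<close>:
  \<open>jac c d q $ b $ a = \<partial>y\<^sup>b / \<partial>x\<^sup>a\<close>, where \<open>x\<close> and \<open>y\<close> are the coordinates of \<open>c\<close> and \<open>d\<close>.\<close>

definition jac :: "'m chart \<Rightarrow> 'm chart \<Rightarrow> 'm \<Rightarrow> real^2^2" where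
  "jac c d q = (\<chi> b a. cpdiff c a (\<lambda>x. snd d x $ b) q)"

definition smooth_fun_on :: "('m, 'z) surface_scheme \<Rightarrow> 'm set \<Rightarrow> ('m \<Rightarrow> 'b::real_normed_vector) \<Rightarrow> bool" where
  "smooth_fun_on M W F \<longleftrightarrow> (\<forall>c\<in>charts M. smooth_on (snd c ` (fst c \<inter> W)) (local_rep c F))"

definition riemannian_surface :: "('m::{t2_space,second_countable_topology}, 'z) surface_scheme \<Rightarrow> bool" where
  "riemannian_surface M \<longleftrightarrow>
     (\<forall>c\<in>charts M. topological_chart c) \<and> \<Union> (fst ` charts M) = UNIV \<and>
     (\<forall>c\<in>charts M. \<forall>d\<in>charts M. smooth_transition c d) \<and>
     (\<forall>c\<in>charts M. \<forall>q\<in>fst c. transpose (metric M c q) = metric M c q \<and>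
        (\<forall>v. v \<noteq> 0 \<longrightarrow> v \<bullet> (metric M c q *v v) > 0)) \<and>
     (\<forall>c\<in>charts M. \<forall>a b. smooth_on (snd c ` fst c) (local_rep c (\<lambda>q. metric M c q $ a $ b))) \<and>
     (\<forall>c\<in>charts M. \<forall>d\<in>charts M. \<forall>q\<in>fst c \<inter> fst d.
        metric M c q = transpose (jac c d q) ** metric M d q ** jac c d q)"

definition orientable :: "('m::topological_space, 'z) surface_scheme \<Rightarrow> bool" where
  "orientable M \<longleftrightarrow> (\<exists>B. (\<forall>c\<in>B. topological_chart c \<and>
        (\<forall>d\<in>charts M. smooth_transition c d \<and> smooth_transition d c)) \<and>
     \<Union> (fst ` B) = UNIV \<and>
     (\<forall>c\<in>B. \<forall>d\<in>B. smooth_transition c d \<and> (\<forall>q\<in>fst c \<inter> fst d. det (jac c d q) > 0)))"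

text \<open>\<open>christoffel M c q a i b\<close> is \<open>\<Gamma>\<^sup>a\<^bsub>ib\<^esub>\<close>, that is, \<open>\<nabla>\<close> of \<open>\<partial>\<^sub>b\<close> in direction \<open>\<partial>\<^sub>i\<close> is
  \<open>\<Sum>a. \<Gamma>\<^sup>a\<^bsub>ib\<^esub> \<partial>\<^sub>a\<close>.\<close>

definition christoffel :: "('m, 'z) surface_scheme \<Rightarrow> 'm chart \<Rightarrow> 'm \<Rightarrow> 2 \<Rightarrow> 2 \<Rightarrow> 2 \<Rightarrow> real" where
  "christoffel M c q a i b = (\<Sum>e\<in>UNIV. matrix_inv (metric M c q) $ a $ e / 2 *
     (cpdiff c i (\<lambda>x. metric M c x $ e $ b) q + cpdiff c b (\<lambda>x. metric M c x $ e $ i) q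
      - cpdiff c e (\<lambda>x. metric M c x $ i $ b) q))"

text \<open>Geodesic completeness (equivalent to metric completeness by the Hopf--Rinow theorem).\<close>

definition geodesic :: "('m::topological_space, 'z) surface_scheme \<Rightarrow> (real \<Rightarrow> 'm) \<Rightarrow> bool" where
  "geodesic M \<gamma> \<longleftrightarrow> continuous_on UNIV \<gamma> \<and>
     (\<forall>c\<in>charts M. \<forall>t. \<gamma> t \<in> fst c \<longrightarrow>
       (let x = snd c \<circ> \<gamma>; x' = (\<lambda>u. vector_derivative x (at u)) in
          (x has_vector_derivative x' t) (at t) \<and>
          (x' has_vector_derivative
             (\<chi> a. - (\<Sum>i\<in>UNIV. \<Sum>b\<in>UNIV. christoffel M c (\<gamma> t) a i b * x' t $ i * x' t $ b))) (at t)))"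

definition complete_surface :: "('m::topological_space, 'z) surface_scheme \<Rightarrow> bool" where
  "complete_surface M \<longleftrightarrow> (\<forall>c\<in>charts M. \<forall>q\<in>fst c. \<forall>v.
     \<exists>\<gamma>. geodesic M \<gamma> \<and> \<gamma> 0 = q \<and> ((snd c \<circ> \<gamma>) has_vector_derivative v) (at 0))"

text \<open>\<open>riemann M c q u v w\<close> is \<open>R(u,v)w\<close> with \<open>R(X,Y) = \<nabla>\<^sub>X\<nabla>\<^sub>Y - \<nabla>\<^sub>Y\<nabla>\<^sub>X - \<nabla>\<^bsub>[X,Y]\<^esub>\<close>.\<close>

definition riemann :: "('m, 'z) surface_scheme \<Rightarrow> 'm chart \<Rightarrow> 'm \<Rightarrow> real^2 \<Rightarrow> real^2 \<Rightarrow> real^2 \<Rightarrow> real^2" where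
  "riemann M c q u v w = (\<chi> a. \<Sum>i\<in>UNIV. \<Sum>j\<in>UNIV. \<Sum>b\<in>UNIV. u $ i * v $ j * w $ b *
     (cpdiff c i (\<lambda>x. christoffel M c x a j b) q - cpdiff c j (\<lambda>x. christoffel M c x a i b) q
      + (\<Sum>e\<in>UNIV. christoffel M c q a i e * christoffel M c q e j b
                  - christoffel M c q a j e * christoffel M c q e i b)))"

definition rinner :: "real^2^2 \<Rightarrow> real^2 \<Rightarrow> real^2 \<Rightarrow> real" where
  "rinner G u v = u \<bullet> (G *v v)"

definition sectional_curvature :: "('m, 'z) surface_scheme \<Rightarrow> 'm chart \<Rightarrow> 'm \<Rightarrow> real^2 \<Rightarrow> real^2 \<Rightarrow> real" where
  "sectional_curvature M c q u v = (let g = rinner (metric M c q) in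
     g (riemann M c q u v v) u / (g u u * g v v - (g u v)\<^sup>2))"

definition constant_curvature :: "('m, 'z) surface_scheme \<Rightarrow> real \<Rightarrow> bool" where
  "constant_curvature M K \<longleftrightarrow> (\<forall>c\<in>charts M. \<forall>q\<in>fst c. \<forall>u v.
     u \<noteq> v \<and> independent {u, v} \<longrightarrow> sectional_curvature M c q u v = K)"


section \<open>Functions, eigenfunctions and parallel sections\<close>

text \<open>Functions on \<open>U\<close> are extended by \<open>0\<close> outside \<open>U\<close>.\<close>

definition Cinf :: "('m, 'z) surface_scheme \<Rightarrow> 'm set \<Rightarrow> ('m \<Rightarrow> complex) set" where
  "Cinf M U = {g. smooth_fun_on M U g \<and> (\<forall>q. q \<notin> U \<longrightarrow> g q = 0)}"

text \<open>Covariant tensor fields of all ranks, in the chart \<open>c\<close>: \<open>T q [i\<^sub>1, \<dots>, i\<^sub>k]\<close> is the value of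
  \<open>T\<close> on \<open>\<partial>\<^bsub>i\<^sub>1\<^esub>, \<dots>, \<partial>\<^bsub>i\<^sub>k\<^esub>\<close>.  The direction of differentiation becomes the first argument.\<close>

definition cov_deriv :: "('m, 'z) surface_scheme \<Rightarrow> 'm chart \<Rightarrow> ('m \<Rightarrow> 2 list \<Rightarrow> complex) \<Rightarrow> 'm \<Rightarrow> 2 list \<Rightarrow> complex" where
  "cov_deriv M c T q is = (case is of [] \<Rightarrow> 0
     | i # as \<Rightarrow> cpdiff c i (\<lambda>x. T x as) q
         - (\<Sum>n<length as. \<Sum>b\<in>UNIV. complex_of_real (christoffel M c q b i (as ! n)) * T q (as[n := b])))"

definition iter_cov :: "('m, 'z) surface_scheme \<Rightarrow> 'm chart \<Rightarrow> nat \<Rightarrow> ('m \<Rightarrow> complex) \<Rightarrow> 'm \<Rightarrow> 2 list \<Rightarrow> complex" where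
  "iter_cov M c k g = (cov_deriv M c ^^ k) (\<lambda>q is. if is = [] then g q else 0)"

definition laplacian :: "('m, 'z) surface_scheme \<Rightarrow> 'm chart \<Rightarrow> ('m \<Rightarrow> complex) \<Rightarrow> 'm \<Rightarrow> complex" where
  "laplacian M c g q = (\<Sum>i\<in>UNIV. \<Sum>j\<in>UNIV.
     complex_of_real (matrix_inv (metric M c q) $ i $ j) * iter_cov M c 2 g q [i, j])"

definition eigenfunction :: "('m, 'z) surface_scheme \<Rightarrow> 'm set \<Rightarrow> ('m \<Rightarrow> complex) \<Rightarrow> bool" where
  "eigenfunction M U f \<longleftrightarrow> f \<in> Cinf M U \<and> (\<exists>q\<in>U. f q \<noteq> 0) \<and>
     (\<exists>ev::complex. \<forall>c\<in>charts M. \<forall>q\<in>fst c \<inter> U. - laplacian M c f q = ev * f q)"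

text \<open>Sections of the complexified tensor bundle \<open>T(E)\<close>: \<open>X c q [a\<^sub>1, \<dots>, a\<^sub>k]\<close> is the coefficient
  of \<open>\<partial>\<^bsub>a\<^sub>1\<^esub> \<otimes> \<dots> \<otimes> \<partial>\<^bsub>a\<^sub>k\<^esub>\<close> in the chart \<open>c\<close>, for all ranks \<open>k\<close> at once.\<close>

type_synonym 'm tensor_section = "'m chart \<Rightarrow> 'm \<Rightarrow> 2 list \<Rightarrow> complex"

definition parallel_section :: "('m, 'z) surface_scheme \<Rightarrow> 'm tensor_section \<Rightarrow> bool" where
  "parallel_section M X \<longleftrightarrow>
     (\<exists>N. \<forall>c\<in>charts M. \<forall>q\<in>fst c. \<forall>as. length as > N \<longrightarrow> X c q as = 0) \<and>
     (\<forall>c\<in>charts M. \<forall>d\<in>charts M. \<forall>q\<in>fst c \<inter> fst d. \<forall>bs.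
        X d q bs = (\<Sum>as | length as = length bs.
          complex_of_real (\<Prod>n<length bs. jac c d q $ (bs ! n) $ (as ! n)) * X c q as)) \<and>
     (\<forall>c\<in>charts M. \<forall>as. smooth_on (snd c ` fst c) (local_rep c (\<lambda>q. X c q as))) \<and>
     (\<forall>c\<in>charts M. \<forall>q\<in>fst c. \<forall>i as.
        cpdiff c i (\<lambda>x. X c x as) q
        + (\<Sum>n<length as. \<Sum>b\<in>UNIV. complex_of_real (christoffel M c q (as ! n) i b) * X c q (as[n := b])) = 0)"

text \<open>The action of a section on functions on \<open>U\<close>, \<open>g \<mapsto> (\<nabla>\<^sup>kg)(X)\<close> in rank \<open>k\<close>.  The value at \<open>q\<close>
  does not depend on the chart around \<open>q\<close> in which it is computed.\<close>

definition section_act :: "('m, 'z) surface_scheme \<Rightarrow> 'm set \<Rightarrow> 'm tensor_section \<Rightarrow> ('m \<Rightarrow> complex) \<Rightarrow> 'm \<Rightarrow> complex" where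
  "section_act M U X g q = (if q \<in> U then
     (let c = (SOME c. c \<in> charts M \<and> q \<in> fst c)
      in \<Sum>as | X c q as \<noteq> 0. X c q as * iter_cov M c (length as) g q as) else 0)"


section \<open>Tensor algebras\<close>

text \<open>Lists form a monoid under concatenation, so the tensor algebra of a complex vector space with
  basis \<open>'a\<close> is the monoid algebra \<open>'a list \<Rightarrow>\<^sub>0 complex\<close>, with the word \<open>[a\<^sub>1, \<dots>, a\<^sub>k]\<close> standing
  for \<open>a\<^sub>1 \<otimes> \<dots> \<otimes> a\<^sub>k\<close>.\<close>

instantiation list :: (type) monoid_add
begin
definition zero_list :: "'a list" where "zero_list = []"
definition plus_list :: "'a list \<Rightarrow> 'a list \<Rightarrow> 'a list" where "plus_list = (@)"
instance by standard (auto simp: zero_list_def plus_list_def)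
end

text \<open>\<open>E\<^sub>p\<close> is \<open>complex^2\<close>, via the coordinate basis \<open>\<partial>\<^sub>1, \<partial>\<^sub>2\<close> of a fixed chart around \<open>p\<close>.\<close>

type_synonym TE = "2 list \<Rightarrow>\<^sub>0 complex"

definition const_TE :: "complex \<Rightarrow> TE" where
  "const_TE z = Poly_Mapping.single [] z"

definition vec_TE :: "complex^2 \<Rightarrow> TE" where
  "vec_TE a = (\<Sum>\<alpha>\<in>UNIV. Poly_Mapping.single [\<alpha>] (a $ \<alpha>))"

definition eval_section :: "'m chart \<Rightarrow> 'm \<Rightarrow> 'm tensor_section \<Rightarrow> TE" where
  "eval_section c p X = Abs_poly_mapping (X c p)"

locale left_module =
  fixes act :: "'r::ring_1 \<Rightarrow> 's::ab_group_add \<Rightarrow> 's"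
  assumes act_add_right: "act a (s + t) = act a s + act a t"
    and act_add_left: "act (a + b) s = act a s + act b s"
    and act_mult: "act (a * b) s = act a (act b s)"
    and act_one: "act 1 s = s"

text \<open>The subspace, in the free vector space on pairs, by which one divides to form
  \<open>T(E\<^sub>p) \<otimes> C\<^sup>\<infinity>(U)\<close> over the algebra of parallel sections.\<close>

definition balanced_relations :: "('m, 'z) surface_scheme \<Rightarrow> 'm chart \<Rightarrow> 'm \<Rightarrow> 'm set \<Rightarrow>
    (TE \<times> ('m \<Rightarrow> complex) \<Rightarrow>\<^sub>0 complex) set" where
  "balanced_relations M c p U = module.span (\<lambda>z. Poly_Mapping.map ((*) z))
    (let \<delta> = (\<lambda>a g. Poly_Mapping.single (a, g) (1::complex)) in
       {\<delta> (a + b) g - \<delta> a g - \<delta> b g | a b g. g \<in> Cinf M U}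
     \<union> {\<delta> a (\<lambda>q. g q + h q) - \<delta> a g - \<delta> a h | a g h. g \<in> Cinf M U \<and> h \<in> Cinf M U}
     \<union> {\<delta> (const_TE z * a) g - Poly_Mapping.single (a, g) z | z a g. g \<in> Cinf M U}
     \<union> {\<delta> a (\<lambda>q. z * g q) - Poly_Mapping.single (a, g) z | z a g. g \<in> Cinf M U}
     \<union> {\<delta> (a * eval_section c p X) g - \<delta> a (section_act M U X g) | a X g.
          parallel_section M X \<and> g \<in> Cinf M U})"

text \<open>\<open>S\<close> together with \<open>\<tau>\<close>, \<open>(a, g) \<mapsto> a \<otimes> g\<close>, is the left \<open>T(E\<^sub>p)\<close>-module
  \<open>T(E\<^sub>p) \<otimes> C\<^sup>\<infinity>(U)\<close> over the algebra of parallel sections: the quotient of the free vector space on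
  pairs by exactly the subspace above, with \<open>T(E\<^sub>p)\<close> acting on the first factor.  The quotient
  depends on \<open>M\<close>, \<open>p\<close> and \<open>U\<close>, so it cannot be a HOL type constructed once and for all; it is
  described here up to isomorphism as an arbitrary type carrying it.\<close>

locale tensor_over_parallel = left_module act
  for act :: "TE \<Rightarrow> 's::ab_group_add \<Rightarrow> 's" +
  fixes M :: "('m, 'z) surface_scheme" and c :: "'m chart" and p :: 'm and U :: "'m set"
    and \<tau> :: "TE \<Rightarrow> ('m \<Rightarrow> complex) \<Rightarrow> 's"
  assumes tensor_surj: "\<And>s. \<exists>\<phi>. Poly_Mapping.keys \<phi> \<subseteq> UNIV \<times> Cinf M U \<and>
      s = (\<Sum>(a, g)\<in>Poly_Mapping.keys \<phi>. act (const_TE (Poly_Mapping.lookup \<phi> (a, g))) (\<tau> a g))"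
    and tensor_kernel: "\<And>\<phi>. Poly_Mapping.keys \<phi> \<subseteq> UNIV \<times> Cinf M U \<Longrightarrow>
      (\<Sum>(a, g)\<in>Poly_Mapping.keys \<phi>. act (const_TE (Poly_Mapping.lookup \<phi> (a, g))) (\<tau> a g)) = 0 \<longleftrightarrow>
      \<phi> \<in> balanced_relations M c p U"
    and tensor_act: "\<And>a b g. g \<in> Cinf M U \<Longrightarrow> act a (\<tau> b g) = \<tau> (a * b) g"


section \<open>The space \<open>F(S)\<close> and its modes\<close>

text \<open>\<open>(\<alpha>, m)\<close> with \<open>m > 0\<close> stands for \<open>\<partial>\<^sub>\<alpha> \<otimes> t\<^bsup>-m\<^esup>\<close>, so \<open>F(S)\<close> consists of the finitely
  supported \<open>S\<close>-valued functions on words in such letters; words containing a letter with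
  \<open>m = 0\<close> are not used.\<close>

type_synonym 's FS = "(2 \<times> nat) list \<Rightarrow>\<^sub>0 's"

definition scaleF :: "(TE \<Rightarrow> 's \<Rightarrow> 's::ab_group_add) \<Rightarrow> complex \<Rightarrow> 's FS \<Rightarrow> 's FS" where
  "scaleF act z = Poly_Mapping.map (act (const_TE z))"

definition cpairing :: "real^2^2 \<Rightarrow> complex^2 \<Rightarrow> complex^2 \<Rightarrow> complex" where
  "cpairing G a b = (\<Sum>\<alpha>\<in>UNIV. \<Sum>\<beta>\<in>UNIV. complex_of_real (G $ \<alpha> $ \<beta>) * a $ \<alpha> * b $ \<beta>)"

definition prepend :: "'a \<Rightarrow> ('a list \<Rightarrow>\<^sub>0 's) \<Rightarrow> 'a list \<Rightarrow>\<^sub>0 's::ab_group_add" where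
  "prepend x \<phi> = (\<Sum>u\<in>Poly_Mapping.keys \<phi>. Poly_Mapping.single (x # u) (Poly_Mapping.lookup \<phi> u))"

text \<open>The action of \<open>a(m)\<close>, \<open>m > 0\<close>, on \<open>u \<otimes> s\<close>, obtained by moving \<open>a(m)\<close> to the right through the
  letters of \<open>u\<close> by the commutation relation until it reaches, and kills, \<open>1 \<otimes> s\<close>.\<close>

primrec contract :: "(TE \<Rightarrow> 's \<Rightarrow> 's) \<Rightarrow> real^2^2 \<Rightarrow> complex \<Rightarrow> complex^2 \<Rightarrow> nat \<Rightarrow> (2 \<times> nat) list \<Rightarrow> 's \<Rightarrow>
    's::ab_group_add FS" where
  "contract act G l a m [] s = 0"
| "contract act G l a m (x # u) s = prepend x (contract act G l a m u s)
     + (if snd x = m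
        then Poly_Mapping.single u (act (const_TE (of_nat m * cpairing G a (axis (fst x) 1) * l)) s)
        else 0)"

definition mode :: "(TE \<Rightarrow> 's \<Rightarrow> 's) \<Rightarrow> real^2^2 \<Rightarrow> complex \<Rightarrow> complex^2 \<Rightarrow> int \<Rightarrow> 's FS \<Rightarrow>
    's::ab_group_add FS" where
  "mode act G l a n \<phi> = (\<Sum>u\<in>Poly_Mapping.keys \<phi>.
     if n < 0 then (\<Sum>\<alpha>\<in>UNIV. Poly_Mapping.single ((\<alpha>, nat (- n)) # u) (act (const_TE (a $ \<alpha>)) (Poly_Mapping.lookup \<phi> u)))
     else if n = 0 then Poly_Mapping.single u (act (vec_TE a) (Poly_Mapping.lookup \<phi> u))
     else contract act G l a (nat n) u (Poly_Mapping.lookup \<phi> u))"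


section \<open>The algebra \<open>V(l,1)\<close> and its action\<close>

datatype pm = HPlus | HMinus

definition bracket :: "pm \<Rightarrow> pm \<Rightarrow> complex" where
  "bracket i j = (if i = j then 0 else 2)"

definition hvec :: "real^2 \<Rightarrow> real^2 \<Rightarrow> pm \<Rightarrow> complex^2" where
  "hvec e1 e2 i = (\<chi> \<alpha>. case i of
     HPlus \<Rightarrow> complex_of_real (e1 $ \<alpha>) - \<i> * complex_of_real (e2 $ \<alpha>)
   | HMinus \<Rightarrow> complex_of_real (e1 $ \<alpha>) + \<i> * complex_of_real (e2 $ \<alpha>))"

definition balanced :: "pm list \<Rightarrow> bool" where
  "balanced is \<longleftrightarrow> count_list is HPlus = count_list is HMinus"

text \<open>The word \<open>[(i\<^sub>1, m\<^sub>1), \<dots>, (i\<^sub>s, m\<^sub>s)]\<close> stands for the product of the \<open>h\<^bsub>i\<^sub>j\<^esub>(-m\<^sub>j)\<close> applied to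
  the vacuum.\<close>

definition Vspace :: "((pm \<times> nat) list \<Rightarrow>\<^sub>0 complex) set" where
  "Vspace = {v. \<forall>ws\<in>Poly_Mapping.keys v. balanced (map fst ws) \<and> (\<forall>x\<in>set ws. snd x > 0)}"

text \<open>Below, \<open>H i n\<close> is the operator \<open>h\<^sub>i(n)\<close>.  Zero modes come last in the normal order, after the
  positive modes.\<close>

definition normal_ordered :: "('i \<Rightarrow> int \<Rightarrow> 'f \<Rightarrow> 'f) \<Rightarrow> ('i \<times> int) list \<Rightarrow> 'f \<Rightarrow> 'f" where
  "normal_ordered H ps u = foldr (\<lambda>(i, n). H i n)
     (filter (\<lambda>x. snd x < 0) ps @ filter (\<lambda>x. snd x > 0) ps @ filter (\<lambda>x. snd x = 0) ps) u"

text \<open>The \<open>(m-1)\<close>-st derivative of \<open>x\<^bsup>-n-1\<^esup>\<close>, divided by \<open>(m-1)!\<close>, is \<open>dcoeff m n\<close> times \<open>x\<^bsup>-n-m\<^esup>\<close>.\<close>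

definition dcoeff :: "nat \<Rightarrow> int \<Rightarrow> complex" where
  "dcoeff m n = (\<Prod>q<m - 1. of_int (- n - 1 - int q)) / fact (m - 1)"

text \<open>The coefficient of \<open>x\<^bsup>-n-1\<^esup>\<close> in \<open>Y(v,x)u\<close> for a word \<open>v\<close>: choosing the mode \<open>ks ! q\<close> in the
  \<open>q\<close>-th factor contributes \<open>x\<close> to the power of minus the sum of all \<open>ks ! q + m\<^sub>q\<close>.  Only finitely
  many choices of \<open>ks\<close> contribute.\<close>

definition word_coeff :: "(TE \<Rightarrow> 's \<Rightarrow> 's) \<Rightarrow> (pm \<Rightarrow> int \<Rightarrow> 's FS \<Rightarrow> 's FS) \<Rightarrow> (pm \<times> nat) list \<Rightarrow> int \<Rightarrow>
    's FS \<Rightarrow> 's::ab_group_add FS" where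
  "word_coeff act H ws n u = Sum_any (\<lambda>ks::int list.
     if length ks = length ws \<and> (\<Sum>q<length ws. ks ! q + int (snd (ws ! q))) = n + 1
     then scaleF act (\<Prod>q<length ws. dcoeff (snd (ws ! q)) (ks ! q))
            (normal_ordered H (zip (map fst ws) ks) u)
     else 0)"

definition Ycoeff :: "(TE \<Rightarrow> 's \<Rightarrow> 's) \<Rightarrow> (pm \<Rightarrow> int \<Rightarrow> 's FS \<Rightarrow> 's FS) \<Rightarrow> ((pm \<times> nat) list \<Rightarrow>\<^sub>0 complex) \<Rightarrow> int \<Rightarrow>
    's FS \<Rightarrow> 's::ab_group_add FS" where
  "Ycoeff act H v n u = (\<Sum>ws\<in>Poly_Mapping.keys v. scaleF act (Poly_Mapping.lookup v ws) (word_coeff act H ws n u))"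

definition VU :: "(TE \<Rightarrow> 's \<Rightarrow> 's) \<Rightarrow> (pm \<Rightarrow> int \<Rightarrow> 's FS \<Rightarrow> 's FS) \<Rightarrow> 's FS \<Rightarrow> 's::ab_group_add FS set" where
  "VU act H F = module.span (scaleF act) {Ycoeff act H v n F | v n. v \<in> Vspace}"

definition FS_weight :: "int \<Rightarrow> 's::zero FS set" where
  "FS_weight d = {\<phi>. \<forall>u\<in>Poly_Mapping.keys \<phi>. int (sum_list (map snd u)) = d}"

text \<open>All \<open>c\<close> with \<open>1 \<le> c\<^sub>k < \<dots> < c\<^sub>1 \<le> s\<close>.\<close>

definition decreasing_tuples :: "nat \<Rightarrow> nat \<Rightarrow> (nat \<Rightarrow> nat) set" where
  "decreasing_tuples k s = {c \<in> {1..k} \<rightarrow>\<^sub>E {1..s}. \<forall>a\<in>{1..k}. \<forall>b\<in>{1..k}. a < b \<longrightarrow> c b < c a}"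

end

theory Submission
  imports Defs
begin

text \<open>Zero modes commute with negative modes and positive modes contract against negative ones, so
  every mode of a generator maps words (negative modes, then zero modes, applied to \<open>f\<close>) to words,
  shifting charge, weight and number of negative modes in a controlled way.  In \<open>v\<^sub>nw\<close> the weight is
  zero, which leaves only the choices of modes with exactly \<open>k\<close> positive and no negative modes; the
  positive ones contract completely, giving a sum over bijections.  Conversely, every balanced word
  lies in the span of the \<open>v\<^sub>nf\<close>, because the coefficients of the normal ordered products form a
  tensor power of an invertible matrix of binomial coefficients.\<close>

section \<open>Modes as linear maps\<close>

text \<open>\<open>VU\<close> is spanned by the coefficients of Y(v,x) applied to \<open>F\<close>
  alone, so neither w nor v_n w lies in it by construction, and a single mode need not preserve it.
  The way around is charge: every word of charge 0 lies in \<open>VU\<close>, so membership becomes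
  additive bookkeeping, mode by mode. The same bookkeeping carries the number of negative modes in a
  word. Each of them has positive weight, so at weight 0 their number must vanish too, and this
  disposes of mixed choices of positive and negative modes without computing them. Negative modes do
  not commute among themselves, nor do zero modes, so words keep their order throughout; only
  complete contractions, being scalars, forget it.\<close>

lemma poly_mapping_eq_sum_single: "\<phi> = (\<Sum>u\<in>Poly_Mapping.keys \<phi>. Poly_Mapping.single u (Poly_Mapping.lookup \<phi> u))"
proof (rule poly_mapping_eqI)
  fix k
  show "Poly_Mapping.lookup \<phi> k = Poly_Mapping.lookup (\<Sum>u\<in>Poly_Mapping.keys \<phi>. Poly_Mapping.single u (Poly_Mapping.lookup \<phi> u)) k"
    by (simp add: lookup_sum lookup_single when_def in_keys_iff)
qed

lemma additive_sum:
  fixes f :: "'a::ab_group_add \<Rightarrow> 'b::ab_group_add"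
  assumes "\<And>x y. f (x + y) = f x + f y"
  shows "f (sum g A) = (\<Sum>x\<in>A. f (g x))"
  using assms by (intro additive.sum) (simp add: Modules.additive_def)

lemma additive_zero:
  fixes f :: "'a::ab_group_add \<Rightarrow> 'b::ab_group_add"
  assumes "\<And>x y. f (x + y) = f x + f y"
  shows "f 0 = 0"
  using assms[of 0 0] by simp

text \<open>Operator identities on F(S) are reduced to elementary tensors by this rule. Additivity
  suffices, because \<open>s\<close> ranges over all coefficients and so absorbs the
  scalars.\<close>

lemma additive_poly_mapping_eqI:
  fixes f g :: "('a \<Rightarrow>\<^sub>0 'b::ab_group_add) \<Rightarrow> 'c::ab_group_add"
  assumes "\<And>x y. f (x + y) = f x + f y" "\<And>x y. g (x + y) = g x + g y"
    and "\<And>u s. f (Poly_Mapping.single u s) = g (Poly_Mapping.single u s)"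
  shows "f \<phi> = g \<phi>"
  by (subst (1 2) poly_mapping_eq_sum_single) (simp add: additive_sum[of f] additive_sum[of g] assms)

lemma sum_keys_superset:
  assumes "finite A" "Poly_Mapping.keys \<phi> \<subseteq> A" "\<And>u. g u 0 = 0"
  shows "(\<Sum>u\<in>Poly_Mapping.keys \<phi>. g u (Poly_Mapping.lookup \<phi> u)) = (\<Sum>u\<in>A. g u (Poly_Mapping.lookup \<phi> u))"
  by (rule sum.mono_neutral_left) (use assms in \<open>auto simp: in_keys_iff\<close>)

text \<open>Cancellation can make the support of a sum smaller, so all three sums are first extended
  to the union of the supports.\<close>

lemma sum_keys_add:
  fixes g :: "'a \<Rightarrow> 'b::ab_group_add \<Rightarrow> 'c::ab_group_add"
  assumes "\<And>u x y. g u (x + y) = g u x + g u y"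
  shows "(\<Sum>u\<in>Poly_Mapping.keys (\<phi> + \<psi>). g u (Poly_Mapping.lookup (\<phi> + \<psi>) u)) =
    (\<Sum>u\<in>Poly_Mapping.keys \<phi>. g u (Poly_Mapping.lookup \<phi> u)) + (\<Sum>u\<in>Poly_Mapping.keys \<psi>. g u (Poly_Mapping.lookup \<psi> u))"
proof -
  let ?A = "Poly_Mapping.keys \<phi> \<union> Poly_Mapping.keys \<psi>"
  have z: "g u 0 = 0" for u using assms by (rule additive_zero)
  have "(\<Sum>u\<in>Poly_Mapping.keys \<xi>. g u (Poly_Mapping.lookup \<xi> u)) = (\<Sum>u\<in>?A. g u (Poly_Mapping.lookup \<xi> u))"
    if "Poly_Mapping.keys \<xi> \<subseteq> ?A" for \<xi>
    by (rule sum_keys_superset) (simp_all add: that z)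
  from this[of "\<phi> + \<psi>"] this[of \<phi>] this[of \<psi>] show ?thesis
    using Poly_Mapping.keys_add[of \<phi> \<psi>] by (simp add: lookup_add assms sum.distrib)
qed

lemma sum_keys_single:
  assumes "\<And>u. g u 0 = 0"
  shows "(\<Sum>u\<in>Poly_Mapping.keys (Poly_Mapping.single v s). g u (Poly_Mapping.lookup (Poly_Mapping.single v s) u)) = g v s"
  using assms by (cases "s = 0") auto

lemma prepend_add: "prepend x (\<phi> + \<psi>) = prepend x \<phi> + prepend x \<psi>"
  unfolding prepend_def by (rule sum_keys_add) (simp add: single_add)

lemma prepend_zero [simp]: "prepend x 0 = 0"
  by (simp add: prepend_def)

lemma prepend_single [simp]: "prepend x (Poly_Mapping.single u s) = Poly_Mapping.single (x # u) s"
  unfolding prepend_def by (rule sum_keys_single) simp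

lemma const_TE_add: "const_TE (z + w) = const_TE z + const_TE w"
  by (simp add: const_TE_def single_add)

lemma const_TE_mult: "const_TE (z * w) = const_TE z * const_TE w"
  by (simp add: const_TE_def mult_single plus_list_def)

lemma const_TE_one [simp]: "const_TE 1 = 1"
  by (simp add: const_TE_def zero_list_def flip: single_one)

lemma const_TE_zero [simp]: "const_TE 0 = 0"
  by (simp add: const_TE_def)

text \<open>The empty word is the unit of the word monoid, so scalars are central. As
  \<open>act (const_TE z)\<close> is the scalar multiplication of the module, this makes every
  \<open>act a\<close> complex linear.\<close>

lemma const_TE_commute: "const_TE z * a = a * const_TE z" 
proof (rule additive_poly_mapping_eqI[where f="\<lambda>a. const_TE z * a" and g="\<lambda>a. a * const_TE z"])
qed (simp_all add: const_TE_def mult_single plus_list_def algebra_simps)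

section \<open>The modes as operators on F(S) and their commutation relations\<close>

locale TE_module = left_module act for act :: "TE \<Rightarrow> 's::ab_group_add \<Rightarrow> 's"
begin

lemma act_zero_right [simp]: "act a 0 = 0"
  using act_add_right by (rule additive_zero)

lemma act_zero_left [simp]: "act 0 s = 0"
  using act_add_left[of 0 0 s] by simp

lemma act_const_commute: "act a (act (const_TE z) s) = act (const_TE z) (act a s)"
  by (metis act_mult const_TE_commute)

lemma act_const_left_commute: "act (const_TE w) (act (const_TE z) s) = act (const_TE z) (act (const_TE w) s)"
  by (rule act_const_commute)

lemma act_vec_const: "act (vec_TE a) (act (const_TE z) s) = act (const_TE z) (act (vec_TE a) s)"
  by (rule act_const_commute)

lemma lookup_scaleF: "Poly_Mapping.lookup (scaleF act z \<phi>) u = act (const_TE z) (Poly_Mapping.lookup \<phi> u)"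
  by (simp add: scaleF_def Poly_Mapping.map.rep_eq when_def)

lemma scaleF_single [simp]: "scaleF act z (Poly_Mapping.single u s) = Poly_Mapping.single u (act (const_TE z) s)"
  by (simp add: scaleF_def)

text \<open>The scalar multiplication depends on \<open>act\<close>, hence is no type class
  instance; the interpretation supplies the theory of spans and subspaces in which \<open>VU\<close>
  is stated.\<close>

sublocale FS: module "scaleF act"
  by unfold_locales (auto intro!: poly_mapping_eqI simp: lookup_scaleF lookup_add act_add_right act_add_left
      const_TE_add const_TE_mult act_mult act_one)

lemma prepend_scaleF: "prepend x (scaleF act z \<phi>) = scaleF act z (prepend x \<phi>)"
  by (rule additive_poly_mapping_eqI) (simp_all add: prepend_add FS.scale_right_distrib)

lemma contract_add: "contract act G l a m u (s + t) = contract act G l a m u s + contract act G l a m u t"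
  by (induction u) (auto simp: prepend_add single_add act_add_right)

lemma contract_scale: "contract act G l a m u (act (const_TE z) s) = scaleF act z (contract act G l a m u s)"
  by (induction u) (auto simp: prepend_scaleF FS.scale_right_distrib act_const_left_commute act_vec_const)

lemma mode_add: "mode act G l a n (\<phi> + \<psi>) = mode act G l a n \<phi> + mode act G l a n \<psi>"
  unfolding mode_def
  by (rule sum_keys_add) (auto simp: single_add act_add_right contract_add sum.distrib)

lemma mode_single: "mode act G l a n (Poly_Mapping.single u s) =
    (if n < 0 then (\<Sum>\<alpha>\<in>UNIV. Poly_Mapping.single ((\<alpha>, nat (- n)) # u) (act (const_TE (a $ \<alpha>)) s))
     else if n = 0 then Poly_Mapping.single u (act (vec_TE a) s)
     else contract act G l a (nat n) u s)"
proof -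
  have "contract act G l a (nat n) u 0 = 0" for u
    using contract_add by (rule additive_zero)
  then show ?thesis
    unfolding mode_def by (intro sum_keys_single) auto
qed

lemma mode_scaleF: "mode act G l a n (scaleF act z \<phi>) = scaleF act z (mode act G l a n \<phi>)"
  by (rule additive_poly_mapping_eqI)
    (simp_all add: mode_add FS.scale_right_distrib mode_single contract_scale act_const_left_commute act_vec_const FS.scale_sum_right)

sublocale mode: module_hom "scaleF act" "scaleF act" "mode act G l a n" for G l a n
  by unfold_locales (simp_all add: mode_add mode_scaleF)

lemma mode_annihilates_vacuum: "n > 0 \<Longrightarrow> mode act G l a n (Poly_Mapping.single [] s) = 0"
  by (simp add: mode_single)

lemma mode_negative_eq: "n > 0 \<Longrightarrow> mode act G l a (- int n) \<phi> = (\<Sum>\<alpha>\<in>UNIV. scaleF act (a $ \<alpha>) (prepend (\<alpha>, n) \<phi>))"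
  by (rule additive_poly_mapping_eqI)
    (simp_all add: mode_add prepend_add FS.scale_right_distrib sum.distrib mode_single)

text \<open>The two operators act on different tensor factors of F(S), up to central
  scalars.\<close>

lemma mode_zero_negative_commute:
  assumes "n > 0"
  shows "mode act G l a 0 (mode act G l b (- int n) \<phi>) = mode act G l b (- int n) (mode act G l a 0 \<phi>)"
  by (rule additive_poly_mapping_eqI[where \<phi> = \<phi>])
    (use assms in \<open>simp_all add: mode_add mode_single mode.sum act_const_left_commute act_vec_const\<close>)

lemma cpairing_sum_right: "cpairing G a b = (\<Sum>\<beta>\<in>UNIV. b $ \<beta> * cpairing G a (axis \<beta> 1))"
  by (auto simp: cpairing_def axis_def sum_2 algebra_simps)

text \<open>For a coordinate vector b the relation is built into \<open>contract\<close>; the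
  general case follows by expanding b in the coordinate basis.\<close>

lemma mode_positive_negative_commute:
  assumes "m > 0" "n > 0"
  shows "mode act G l a (int m) (mode act G l b (- int n) \<phi>) = mode act G l b (- int n) (mode act G l a (int m) \<phi>)
    + scaleF act (if m = n then of_nat m * cpairing G a b * l else 0) \<phi>"
proof (rule additive_poly_mapping_eqI[where \<phi> = \<phi>])
  fix u :: "(2 \<times> nat) list" and s :: 's
  let ?u = "Poly_Mapping.single u s"
  have "scaleF act (of_nat m * cpairing G a b * l) ?u =
    (\<Sum>\<beta>\<in>UNIV. scaleF act (b $ \<beta>) (scaleF act (of_nat m * cpairing G a (axis \<beta> 1) * l) ?u))"
    by (subst cpairing_sum_right)
      (simp only: sum_distrib_left sum_distrib_right FS.scale_scale FS.scale_sum_left mult_ac)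
  then show "mode act G l a (int m) (mode act G l b (- int n) ?u) = mode act G l b (- int n) (mode act G l a (int m) ?u)
    + scaleF act (if m = n then of_nat m * cpairing G a b * l else 0) ?u"
    using assms
    by (cases "m = n") (simp_all add: mode_negative_eq mode.sum mode_single sum.distrib contract_scale prepend_scaleF act_const_left_commute)
qed (simp_all add: mode_add FS.scale_right_distrib)

end

section \<open>Grading\<close>

text \<open>An additive form of balance: unlike \<open>balanced\<close>, the sum of signs can be
  followed through each single mode.\<close>

fun charge :: "pm \<Rightarrow> int" where
  "charge HPlus = 1"
| "charge HMinus = -1"

lemma balanced_iff_charge: "balanced is \<longleftrightarrow> (\<Sum>i\<leftarrow>is. charge i) = 0"
proof -
  have "(\<Sum>i\<leftarrow>is. charge i) = int (count_list is HPlus) - int (count_list is HMinus)"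
  proof (induction "is")
    case (Cons i "is")
    then show ?case by (cases i) auto
  qed simp
  then show ?thesis by (simp add: balanced_def)
qed

text \<open>A contraction removes two opposite signs, so it respects charge.\<close>

lemma bracket_nonzero_charge: "bracket i j \<noteq> 0 \<Longrightarrow> charge i + charge j = 0"
  by (cases i; cases j) (simp_all add: bracket_def)

text \<open>Of the frame at p this keeps the pairing values of the null vectors; \<open>s0\<close>
  will be \<open>\<tau> 1 f\<close>.\<close>

locale heisenberg_modes = TE_module act for act :: "TE \<Rightarrow> 's::ab_group_add \<Rightarrow> 's" +
  fixes G :: "real^2^2" and l :: complex and hv :: "pm \<Rightarrow> complex^2" and s0 :: 's
  assumes cpairing_hv: "cpairing G (hv i) (hv j) = bracket i j"
begin

abbreviation h :: "pm \<Rightarrow> int \<Rightarrow> 's FS \<Rightarrow> 's FS" where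
  "h \<equiv> \<lambda>i. mode act G l (hv i)"

abbreviation zero_word :: "pm list \<Rightarrow> 's FS" where
  "zero_word is \<equiv> foldr (\<lambda>i. h i 0) is (Poly_Mapping.single [] s0)"

definition word :: "(pm \<times> nat) list \<Rightarrow> pm list \<Rightarrow> 's FS" where
  "word A B = foldr (\<lambda>(i, t). h i (- int t)) A (zero_word B)"

lemma word_Nil: "word [] B = zero_word B"
  by (simp add: word_def)

lemma word_Cons: "word ((i, t) # A) B = h i (- int t) (word A B)"
  by (simp add: word_def)

lemma zero_word_eq_single: "\<exists>s. zero_word B = Poly_Mapping.single [] s"
proof (induction B)
  case (Cons i B)
  then obtain s where "zero_word B = Poly_Mapping.single [] s" by blast
  then show ?case by (auto simp: mode_single)
qed auto

lemma zero_mode_word: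
  "\<forall>x\<in>set A. snd x > 0 \<Longrightarrow> h i 0 (word A B) = word A (i # B)"
proof (induction A)
  case (Cons x A)
  then show ?case
    by (cases x) (simp add: word_Cons mode_zero_negative_commute)
qed (simp add: word_Nil)

lemma positive_mode_word_Nil: "n > 0 \<Longrightarrow> h i n (word [] B) = 0"
  using zero_word_eq_single[of B] by (auto simp: word_Nil mode_annihilates_vacuum)

lemma positive_mode_word_Cons:
  assumes "n > 0" "t > 0"
  shows "h i (int n) (word ((j, t) # A) B) = h j (- int t) (h i (int n) (word A B)) +
    scaleF act (if n = t then of_nat n * bracket i j * l else 0) (word A B)"
  using mode_positive_negative_commute[OF assms] by (simp add: word_Cons cpairing_hv)

definition graded_words :: "int \<Rightarrow> int \<Rightarrow> int \<Rightarrow> 's FS set" where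
  "graded_words \<delta> d a = {word A B | A B. (\<forall>x\<in>set A. snd x > 0) \<and>
     (\<Sum>x\<leftarrow>A. charge (fst x)) + (\<Sum>i\<leftarrow>B. charge i) = \<delta> \<and>
     (\<Sum>x\<leftarrow>A. int (snd x)) = d \<and> int (length A) = a}"

text \<open>The indices are charge, weight and number of negative modes. Words may be linearly
  dependent (zero modes satisfy relations on an eigenfunction), so degrees are recorded as
  membership in spans, not as a function of the vector.\<close>

definition graded_part :: "int \<Rightarrow> int \<Rightarrow> int \<Rightarrow> 's FS set" where
  "graded_part \<delta> d a = FS.span (graded_words \<delta> d a)"

lemma word_in_graded_part:
  assumes "\<forall>x\<in>set A. snd x > 0" "(\<Sum>x\<leftarrow>A. charge (fst x)) + (\<Sum>i\<leftarrow>B. charge i) = \<delta>"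
    "(\<Sum>x\<leftarrow>A. int (snd x)) = d" "int (length A) = a"
  shows "word A B \<in> graded_part \<delta> d a"
  unfolding graded_part_def using assms by (intro FS.span_base) (auto simp: graded_words_def)

lemma mode_graded_partI:
  assumes "\<And>A B. \<lbrakk>\<forall>x\<in>set A. snd x > 0; (\<Sum>x\<leftarrow>A. charge (fst x)) + (\<Sum>i\<leftarrow>B. charge i) = \<delta>;
      (\<Sum>x\<leftarrow>A. int (snd x)) = d; int (length A) = a\<rbrakk> \<Longrightarrow> h i n (word A B) \<in> graded_part \<delta>' d' a'"
    and "\<phi> \<in> graded_part \<delta> d a"
  shows "h i n \<phi> \<in> graded_part \<delta>' d' a'"
proof -
  have "FS.span (h i n ` graded_words \<delta> d a) \<subseteq> graded_part \<delta>' d' a'"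
    unfolding graded_part_def
    by (intro FS.span_minimal FS.subspace_span) (use assms(1) in \<open>auto simp: graded_words_def graded_part_def\<close>)
  then show ?thesis
    using assms(2) by (auto simp: mode.span_image graded_part_def)
qed

lemma negative_mode_graded:
  assumes "n < 0" "\<phi> \<in> graded_part \<delta> d a"
  shows "h i n \<phi> \<in> graded_part (\<delta> + charge i) (d - n) (a + 1)"
proof (rule mode_graded_partI[OF _ assms(2)])
  fix A B
  assume *: "\<forall>x\<in>set A. snd x > 0" "(\<Sum>x\<leftarrow>A. charge (fst x)) + (\<Sum>i\<leftarrow>B. charge i) = \<delta>"
      "(\<Sum>x\<leftarrow>A. int (snd x)) = d" "int (length A) = a"
  have "h i n (word A B) = word ((i, nat (- n)) # A) B"
    using assms(1) by (simp add: word_Cons)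
  also have "\<dots> \<in> graded_part (\<delta> + charge i) (d - n) (a + 1)"
    using * assms(1) by (intro word_in_graded_part) auto
  finally show "h i n (word A B) \<in> graded_part (\<delta> + charge i) (d - n) (a + 1)" .
qed

text \<open>Moving the mode past the first letter leaves a commutator term only if that letter has
  weight n and opposite sign. Dropping the letter then lowers the weight by n and the count by 1,
  and losing \<open>charge j\<close> is the same as gaining \<open>charge i\<close>.\<close>

lemma positive_mode_graded:
  assumes "n > 0" "\<phi> \<in> graded_part \<delta> d a"
  shows "h i n \<phi> \<in> graded_part (\<delta> + charge i) (d - n) (a - 1)"
proof -
  have "h i n (word A B) \<in> graded_part ((\<Sum>x\<leftarrow>A. charge (fst x)) + (\<Sum>i\<leftarrow>B. charge i) + charge i)
      ((\<Sum>x\<leftarrow>A. int (snd x)) - n) (int (length A) - 1)"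
    if "\<forall>x\<in>set A. snd x > 0" for A B
    using that
  proof (induction A)
    case Nil
    then show ?case using assms(1) by (simp add: positive_mode_word_Nil graded_part_def FS.span_zero)
  next
    case (Cons x A)
    obtain j t where x: "x = (j, t)" and t: "t > 0" using Cons.prems by (cases x) auto
    let ?P = "graded_part ((\<Sum>x\<leftarrow>x # A. charge (fst x)) + (\<Sum>i\<leftarrow>B. charge i) + charge i)
      ((\<Sum>x\<leftarrow>x # A. int (snd x)) - n) (int (length (x # A)) - 1)"
    have "h j (- int t) (h i n (word A B)) \<in> ?P"
      using negative_mode_graded[OF _ Cons.IH, of "- int t" j] Cons.prems t by (simp add: x algebra_simps)
    moreover have "scaleF act (if nat n = t then of_nat (nat n) * bracket i j * l else 0) (word A B) \<in> ?P"
    proof (cases "nat n = t \<and> bracket i j \<noteq> 0")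
      case True
      then have "word A B \<in> ?P"
        using Cons.prems assms(1) bracket_nonzero_charge[of i j] by (intro word_in_graded_part) (auto simp: x)
      then show ?thesis unfolding graded_part_def by (rule FS.span_scale)
    next
      case False
      then show ?thesis by (auto simp: graded_part_def FS.span_zero)
    qed
    ultimately show ?case
      using positive_mode_word_Cons[of "nat n" t i j A B] assms(1) t
      by (simp add: x graded_part_def FS.span_add)
  qed
  then show ?thesis by (intro mode_graded_partI[OF _ assms(2)]) auto
qed

lemma mode_graded:
  assumes "\<phi> \<in> graded_part \<delta> d a"
  shows "h i n \<phi> \<in> graded_part (\<delta> + charge i) (d - n) (a - sgn n)"
proof (cases n "0::int" rule: linorder_cases)
  case equal
  have "h i 0 \<phi> \<in> graded_part (\<delta> + charge i) d a"
    by (intro mode_graded_partI[OF _ assms]) (auto simp: zero_mode_word intro!: word_in_graded_part)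
  then show ?thesis by (simp add: equal)
qed (use negative_mode_graded positive_mode_graded assms in auto)

lemma modes_graded:
  assumes "\<phi> \<in> graded_part \<delta> d a"
  shows "foldr (\<lambda>(i, n). h i n) ps \<phi> \<in>
    graded_part (\<delta> + (\<Sum>x\<leftarrow>ps. charge (fst x))) (d - (\<Sum>x\<leftarrow>ps. snd x)) (a - (\<Sum>x\<leftarrow>ps. sgn (snd x)))"
proof (induction ps)
  case (Cons x ps)
  from mode_graded[OF Cons, of "fst x" "snd x"] show ?case
    by (simp add: case_prod_beta algebra_simps)
qed (simp add: assms)

lemma sum_list_filter_trichotomy:
  fixes g :: "'i \<times> int \<Rightarrow> int"
  shows "sum_list (map g (filter (\<lambda>x. snd x < 0) ps @ filter (\<lambda>x. snd x > 0) ps @ filter (\<lambda>x. snd x = 0) ps))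
    = sum_list (map g ps)"
  by (induction ps) auto

lemma normal_ordered_graded:
  assumes "\<phi> \<in> graded_part \<delta> d a"
  shows "normal_ordered h ps \<phi> \<in>
    graded_part (\<delta> + (\<Sum>x\<leftarrow>ps. charge (fst x))) (d - (\<Sum>x\<leftarrow>ps. snd x)) (a - (\<Sum>x\<leftarrow>ps. sgn (snd x)))"
  using modes_graded[OF assms, of "filter (\<lambda>x. snd x < 0) ps @ filter (\<lambda>x. snd x > 0) ps @ filter (\<lambda>x. snd x = 0) ps"]
  unfolding normal_ordered_def sum_list_filter_trichotomy .

text \<open>Letters have positive weight, so weight 0 admits only words without letters. This is the
  source of all vanishing statements below, the last alternative being the decisive one at lowest
  weight.\<close>

lemma graded_part_trivial:
  assumes "d < 0 \<or> a < 0 \<or> (d = 0 \<and> a \<noteq> 0)"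
  shows "graded_part \<delta> d a = {0}"
proof -
  have "A = []" if "\<forall>x\<in>set A. snd x > 0" "(\<Sum>x\<leftarrow>A. int (snd x)) \<le> 0" for A :: "(pm \<times> nat) list"
  proof (cases A)
    case (Cons x A')
    have "(\<Sum>x\<leftarrow>A'. int (snd x)) \<ge> 0" by (rule sum_list_nonneg) auto
    then show ?thesis using that Cons by auto
  qed simp
  then have "graded_words \<delta> d a = {}"
    using assms by (fastforce simp: graded_words_def)
  then show ?thesis by (simp add: graded_part_def)
qed

section \<open>Comparison with the weight grading of F(S)\<close>

lemma subspace_FS_weight: "FS.subspace (FS_weight d)"
  unfolding FS_weight_def
  by (rule FS.subspaceI) (auto simp: in_keys_iff lookup_scaleF lookup_add)

lemma prepend_FS_weight:
  assumes "\<phi> \<in> FS_weight d"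
  shows "prepend x \<phi> \<in> FS_weight (d + int (snd x))"
proof -
  have "Poly_Mapping.keys (prepend x \<phi>) \<subseteq> (#) x ` Poly_Mapping.keys \<phi>"
    unfolding prepend_def by (rule order_trans[OF Poly_Mapping.keys_sum]) auto
  then show ?thesis using assms by (auto simp: FS_weight_def)
qed

lemma word_FS_weight:
  "\<forall>x\<in>set A. snd x > 0 \<Longrightarrow> word A B \<in> FS_weight (\<Sum>x\<leftarrow>A. int (snd x))"
proof (induction A)
  case Nil
  obtain s where "zero_word B = Poly_Mapping.single [] s" using zero_word_eq_single by blast
  then show ?case by (auto simp: word_Nil FS_weight_def)
next
  case (Cons x A)
  have "prepend (\<alpha>, snd x) (word A B) \<in> FS_weight (\<Sum>x\<leftarrow>x # A. int (snd x))" for \<alpha>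
    using prepend_FS_weight[OF Cons.IH, of "(\<alpha>, snd x)"] Cons.prems by (simp add: add.commute)
  then show ?case
    using Cons.prems
    by (cases x) (auto simp: word_Cons mode_negative_eq intro!: FS.subspace_sum FS.subspace_scale subspace_FS_weight)
qed

lemma graded_part_FS_weight: "graded_part \<delta> d a \<subseteq> FS_weight d"
  unfolding graded_part_def
  by (intro FS.span_minimal subspace_FS_weight) (auto simp: graded_words_def word_FS_weight)

end

section \<open>Balanced words\<close>

lemma triangular_system_solvable:
  fixes g :: "nat \<Rightarrow> nat \<Rightarrow> 'a::field"
  assumes "\<And>a b. b < a \<Longrightarrow> a \<le> N \<Longrightarrow> g a b = 0" and "\<And>a. a \<le> N \<Longrightarrow> g a a \<noteq> 0"
  shows "\<exists>c. \<forall>b\<le>N. (\<Sum>a\<le>N. c a * g a b) = y b"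
  using assms
proof (induction N)
  case 0
  then show ?case by (intro exI[of _ "\<lambda>_. y 0 / g 0 0"]) auto
next
  case (Suc N)
  then obtain c where c: "\<And>b. b \<le> N \<Longrightarrow> (\<Sum>a\<le>N. c a * g a b) = y b" by auto
  \<comment> \<open>The new unknown enters equation b with the factor \<open>g (Suc N) b\<close>,
    which is 0 for b up to N: the old equations survive and the last one determines the
    unknown.\<close>
  define c' where "c' = c(Suc N := (y (Suc N) - (\<Sum>a\<le>N. c a * g a (Suc N))) / g (Suc N) (Suc N))"
  have "(\<Sum>a\<le>Suc N. c' a * g a b) = (\<Sum>a\<le>N. c a * g a b) + c' (Suc N) * g (Suc N) b" for b
    by (simp add: c'_def)
  then have "(\<Sum>a\<le>Suc N. c' a * g a b) = y b" if "b \<le> Suc N" for b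
    using that c[of b] Suc.prems by (cases "b = Suc N") (auto simp: c'_def)
  then show ?case by blast
qed

text \<open>\<open>dcoeff (a + 1) (- d)\<close> is the binomial coefficient of \<open>d - 1\<close> over \<open>a\<close>; in the order
  \<open>1, \<dots>, D, 0\<close> of the nodes \<open>d\<close> this matrix is triangular.\<close>

lemma dcoeff_interpolation:
  fixes y :: "nat \<Rightarrow> complex"
  shows "\<exists>c. \<forall>d\<le>D. (\<Sum>a=1..Suc D. c a * dcoeff a (- int d)) = y d"
proof -
  \<comment> \<open>At d = b + 1 the binomial coefficient vanishes for a > b, but at d = 0 it is the
    binomial coefficient of -1 over a, a sign that never vanishes; the node 0 therefore has to come
    last.\<close>
  define node where "node b = (if b < D then Suc b else 0)" for b
  have "dcoeff (Suc a) (- int (node b)) = 0" if "b < a" "a \<le> D" for a b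
  proof -
    have "(\<Prod>q<a. (of_int (int (node b) - 1 - int q) :: complex)) = 0"
      using that by (intro prod_zero) (auto simp: node_def intro!: bexI[of _ b])
    then show ?thesis by (simp add: dcoeff_def)
  qed
  moreover have "dcoeff (Suc a) (- int (node a)) \<noteq> 0" if "a \<le> D" for a
  proof -
    have "(\<Prod>q<a. (of_int (int (node a) - 1 - int q) :: complex)) \<noteq> 0"
      using that by (subst prod_zero_iff) (auto simp: node_def simp del: of_int_diff)
    then show ?thesis by (simp add: dcoeff_def)
  qed
  ultimately obtain c where c: "\<And>b. b \<le> D \<Longrightarrow> (\<Sum>a\<le>D. c a * dcoeff (Suc a) (- int (node b))) = y (node b)"
    using triangular_system_solvable[of D "\<lambda>a b. dcoeff (Suc a) (- int (node b))" "\<lambda>b. y (node b)"] by blast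
  have "(\<Sum>a=1..Suc D. c (a - 1) * dcoeff a (- int d)) = y d" if "d \<le> D" for d
  proof -
    have "(\<Sum>a=1..Suc D. c (a - 1) * dcoeff a (- int d)) = (\<Sum>a\<le>D. c a * dcoeff (Suc a) (- int d))"
      by (simp add: sum.atLeast_Suc_atMost_Suc_shift atMost_atLeast0 del: sum.cl_ivl_Suc)
    moreover obtain b where "b \<le> D" "node b = d"
      using \<open>d \<le> D\<close> by (intro that[of "if d = 0 then D else d - 1"]) (auto simp: node_def)
    ultimately show ?thesis using c[of b] by simp
  qed
  then show ?thesis by (intro exI[of _ "\<lambda>a. c (a - 1)"]) auto
qed

text \<open>With the total fixed, an upper bound on all entries forces a lower bound on each. This
  makes the coefficients of Y(v,x) finite sums, although negative modes are unbounded
  individually.\<close>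

lemma finite_bounded_above_fixed_sum:
  fixes D c :: int
  assumes "D \<ge> 0"
  shows "finite {ks. length ks = N \<and> (\<forall>k\<in>set ks. k \<le> D) \<and> sum_list ks = c}"
proof (rule finite_subset)
  show "finite {ks. set ks \<subseteq> {c - int N * D..D} \<and> length ks = N}"
    by (rule finite_lists_length_eq) simp
  show "{ks. length ks = N \<and> (\<forall>k\<in>set ks. k \<le> D) \<and> sum_list ks = c} \<subseteq>
    {ks. set ks \<subseteq> {c - int N * D..D} \<and> length ks = N}"
  proof safe
    fix ks :: "int list" and k
    assume *: "\<forall>k\<in>set ks. k \<le> D" "k \<in> set ks"
    have "D - k \<le> sum_list (map (\<lambda>x. D - x) ks)"
      using * by (intro member_le_sum_list) auto
    also have "\<dots> = int (length ks) * D - sum_list ks"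
      by (induction ks) (auto simp: algebra_simps)
    finally show "k \<in> {sum_list ks - int (length ks) * D..D}"
      using * assms by auto
  qed
qed

lemma sum_modes_and_weights:
  assumes "length ks = length ws"
  shows "(\<Sum>q<length ws. ks ! q + int (snd (ws ! q))) = sum_list ks + (\<Sum>x\<leftarrow>ws. int (snd x))"
  using assms by (simp add: sum.distrib sum_list_sum_nth atLeast0LessThan)

section \<open>Coefficients of Y(v,x) as finite sums, and membership in \<open>VU\<close>\<close>

context heisenberg_modes
begin

abbreviation vac :: "'s FS" where
  "vac \<equiv> Poly_Mapping.single [] s0"

lemma foldr_mode_zero: "foldr (\<lambda>(i, n). h i n) ps 0 = 0"
  by (induction ps) (auto simp: mode.zero)

lemma vac_graded: "vac \<in> graded_part 0 0 0"
  using word_in_graded_part[of "[]" "[]"] by (simp add: word_Nil)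

text \<open>Normal order lets zero and positive modes act before the negative ones, so the weight is
  already below 0 when the first negative mode could raise it again.\<close>

lemma normal_ordered_eq_0:
  assumes "\<phi> \<in> graded_part \<delta> d a" "x \<in> set ps" "snd x > 0" "snd x > d"
  shows "normal_ordered h ps \<phi> = 0"
proof -
  let ?P = "filter (\<lambda>x. snd x > 0) ps" and ?Z = "filter (\<lambda>x. snd x = 0) ps"
  have "snd x \<le> (\<Sum>x\<leftarrow>?P. snd x)"
    using assms(2,3) by (intro member_le_sum_list) auto
  moreover have "(\<Sum>x\<leftarrow>?Z. snd x) = 0"
    by (induction ps) auto
  ultimately have "foldr (\<lambda>(i, n). h i n) (?P @ ?Z) \<phi> = 0"
    using modes_graded[OF assms(1), of "?P @ ?Z"] assms(4) by (simp add: graded_part_trivial)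
  then show ?thesis by (simp add: normal_ordered_def foldr_mode_zero)
qed

text \<open>\<open>Sum_any\<close> is 0 by convention on infinite support, so a finite set
  containing the support must be exhibited before it can be used as a sum.\<close>

lemma word_coeff_eq_sum:
  assumes "finite A"
    and "\<And>ks. length ks = length ws \<Longrightarrow> sum_list ks = n + 1 - (\<Sum>x\<leftarrow>ws. int (snd x)) \<Longrightarrow> ks \<notin> A \<Longrightarrow>
      normal_ordered h (zip (map fst ws) ks) u = 0"
  shows "word_coeff act h ws n u = (\<Sum>ks\<in>A.
     if length ks = length ws \<and> sum_list ks = n + 1 - (\<Sum>x\<leftarrow>ws. int (snd x))
     then scaleF act (\<Prod>q<length ws. dcoeff (snd (ws ! q)) (ks ! q)) (normal_ordered h (zip (map fst ws) ks) u)
     else 0)"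
proof -
  have "word_coeff act h ws n u = Sum_any (\<lambda>ks.
     if length ks = length ws \<and> sum_list ks = n + 1 - (\<Sum>x\<leftarrow>ws. int (snd x))
     then scaleF act (\<Prod>q<length ws. dcoeff (snd (ws ! q)) (ks ! q)) (normal_ordered h (zip (map fst ws) ks) u)
     else 0)"
    unfolding word_coeff_def
    by (intro Sum_any.cong if_cong) (auto simp: sum_modes_and_weights)
  also have "\<dots> = (\<Sum>ks\<in>A.
     if length ks = length ws \<and> sum_list ks = n + 1 - (\<Sum>x\<leftarrow>ws. int (snd x))
     then scaleF act (\<Prod>q<length ws. dcoeff (snd (ws ! q)) (ks ! q)) (normal_ordered h (zip (map fst ws) ks) u)
     else 0)"
    by (rule Sum_any.expand_superset[OF assms(1)]) (use assms(2) in \<open>fastforce split: if_splits\<close>)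
  finally show ?thesis .
qed

text \<open>\<open>D\<close> is the weight of the argument, beyond which a positive mode kills, and
  \<open>c\<close> is the total that the index n prescribes.\<close>

definition relevant_modes :: "nat \<Rightarrow> int \<Rightarrow> int \<Rightarrow> int list set" where
  "relevant_modes N D c = {ks. length ks = N \<and> (\<forall>k\<in>set ks. k \<le> D) \<and> sum_list ks = c}"

lemma word_coeff_graded_eq:
  assumes "u \<in> graded_part \<delta> d a" "d \<ge> 0"
  shows "word_coeff act h ws n u = (\<Sum>ks\<in>relevant_modes (length ws) d (n + 1 - (\<Sum>x\<leftarrow>ws. int (snd x))).
     scaleF act (\<Prod>q<length ws. dcoeff (snd (ws ! q)) (ks ! q)) (normal_ordered h (zip (map fst ws) ks) u))"
proof -
  have "normal_ordered h (zip (map fst ws) ks) u = 0"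
    if "length ks = length ws" "k \<in> set ks" "k > d" for ks k
  proof -
    from that obtain q where "q < length ws" "k = ks ! q" by (auto simp: in_set_conv_nth)
    then have "(fst (ws ! q), k) \<in> set (zip (map fst ws) ks)"
      using that by (auto simp: set_zip intro!: exI[of _ q])
    then show ?thesis using that assms by (intro normal_ordered_eq_0[OF assms(1)]) auto
  qed
  then show ?thesis
    by (subst word_coeff_eq_sum[where A="relevant_modes (length ws) d (n + 1 - (\<Sum>x\<leftarrow>ws. int (snd x)))"])
      (auto simp: relevant_modes_def not_le finite_bounded_above_fixed_sum assms intro!: sum.cong)
qed

lemma Ycoeff_single: "Ycoeff act h (Poly_Mapping.single ws 1) n u = word_coeff act h ws n u"
  by (simp add: Ycoeff_def)

lemma Ycoeff_in_VU: "v \<in> Vspace \<Longrightarrow> Ycoeff act h v n vac \<in> VU act h vac"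
  unfolding VU_def by (rule FS.span_base) auto

lemma word_eq_normal_ordered:
  assumes "\<forall>x\<in>set A. snd x > 0"
  shows "normal_ordered h (map (\<lambda>x. (fst x, - int (snd x))) (A @ map (\<lambda>i. (i, 0)) B)) vac = word A B"
proof -
  have "filter (\<lambda>x. - int (snd x) < 0) A = A" "filter (\<lambda>x. - int (snd x) > 0) A = []"
    "filter (\<lambda>x. snd x = 0) A = []"
    using assms by (auto simp: filter_id_conv filter_empty_conv)
  then show ?thesis
    by (simp add: normal_ordered_def word_def filter_map o_def foldr_map case_prod_unfold)
qed

text \<open>The signs are kept fixed while the weights \<open>\<alpha>\<close> of the factors of v
  vary. All resulting coefficients are combinations of the same normal ordered products, with
  product coefficients, so solving one interpolation problem per factor isolates the desired
  product.\<close>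

lemma word_in_VU:
  assumes pos: "\<forall>x\<in>set A. snd x > 0" and bal: "balanced (map fst A @ B)"
  shows "word A B \<in> VU act h vac"
proof -
  \<comment> \<open>Zero modes are treated as further letters, of weight 0, so that one
    interpolation handles both kinds.\<close>
  define ps where "ps = A @ map (\<lambda>i. (i, 0::nat)) B"
  define r where "r = length ps"
  define D where "D = (\<Sum>x\<leftarrow>ps. snd x)"
  define ks0 where "ks0 = map (\<lambda>x. - int (snd x)) ps"
  define NO where "NO ks = normal_ordered h (zip (map fst ps) ks) vac" for ks
  define K where "K = relevant_modes r 0 (- int D)"
  have "\<forall>q. \<exists>c. \<forall>d\<le>D. (\<Sum>a=1..Suc D. c a * dcoeff a (- int d)) = (if d = snd (ps ! q) then 1 else 0)"
    by (intro allI dcoeff_interpolation)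
  from choice[OF this] obtain c where c: "\<And>q d. d \<le> D \<Longrightarrow> (\<Sum>a=1..Suc D. c q a * dcoeff a (- int d)) = (if d = snd (ps ! q) then 1 else 0)"
    by blast
  define ws where "ws \<alpha> = map (\<lambda>q. (fst (ps ! q), \<alpha> q)) [0..<r]" for \<alpha> :: "nat \<Rightarrow> nat"
  have fst_ws: "map fst (ws \<alpha>) = map fst ps" for \<alpha>
    by (rule nth_equalityI) (simp_all add: ws_def r_def)
  \<comment> \<open>\<open>Suc D\<close> unknowns per factor match the nodes 0, ..., D.\<close>
  define E where "E = PiE {..<r} (\<lambda>_. {1..Suc D})"
  \<comment> \<open>This index makes the modes add up to \<open>- D\<close> whatever
    \<open>\<alpha>\<close> is, so every coefficient is a sum over the same set
    \<open>K\<close>.\<close>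
  define N where "N \<alpha> = (\<Sum>x\<leftarrow>ws \<alpha>. int (snd x)) - int D - 1" for \<alpha>
  have coeff: "word_coeff act h (ws \<alpha>) (N \<alpha>) vac = (\<Sum>ks\<in>K. scaleF act (\<Prod>q<r. dcoeff (\<alpha> q) (ks ! q)) (NO ks))" for \<alpha>
  proof -
    have "length (ws \<alpha>) = r" "N \<alpha> + 1 - (\<Sum>x\<leftarrow>ws \<alpha>. int (snd x)) = - int D" by (simp_all add: ws_def N_def)
    moreover have "snd (ws \<alpha> ! q) = \<alpha> q" if "q < r" for q using that by (simp add: ws_def)
    ultimately show ?thesis
      by (subst word_coeff_graded_eq[OF vac_graded]) (simp_all add: K_def NO_def fst_ws)
  qed
  have member: "word_coeff act h (ws \<alpha>) (N \<alpha>) vac \<in> VU act h vac" if "\<alpha> \<in> E" for \<alpha>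
  proof -
    have "balanced (map fst (ws \<alpha>))" using bal by (simp add: fst_ws ps_def o_def)
    moreover have "\<forall>x\<in>set (ws \<alpha>). snd x > 0" using that by (auto simp: ws_def E_def PiE_def Pi_def Suc_le_eq)
    ultimately show ?thesis
      using Ycoeff_in_VU[of "Poly_Mapping.single (ws \<alpha>) 1" "N \<alpha>"]
      by (simp add: Vspace_def Ycoeff_single)
  qed
  have finK: "finite K" by (simp add: K_def relevant_modes_def finite_bounded_above_fixed_sum)
  \<comment> \<open>Nonpositive entries with total \<open>- D\<close> lie between \<open>- D\<close>
    and 0, that is, at interpolation nodes.\<close>
  have neg: "\<exists>d\<le>D. ks ! q = - int d" if "ks \<in> K" "q < r" for ks q
  proof -
    have nonpos: "\<forall>k\<in>set ks. k \<le> 0" and sum: "sum_list ks = - int D" and "ks ! q \<in> set ks"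
      using that by (auto simp: K_def relevant_modes_def)
    have "- (ks ! q) \<le> sum_list (map uminus ks)"
      using nonpos \<open>ks ! q \<in> set ks\<close> by (intro member_le_sum_list) auto
    also have "\<dots> = - sum_list ks" by (induction ks) auto
    also have "\<dots> = int D" using sum by simp
    finally show ?thesis using nonpos \<open>ks ! q \<in> set ks\<close> by (intro exI[of _ "nat (- (ks ! q))"]) auto
  qed
  have "(\<Prod>q<r. \<Sum>a=1..Suc D. c q a * dcoeff a (ks ! q)) = (if ks = ks0 then 1 else 0)" if "ks \<in> K" for ks
  proof -
    have "(\<Sum>a=1..Suc D. c q a * dcoeff a (ks ! q)) = (if ks ! q = ks0 ! q then 1 else 0)" if "q < r" for q
      using neg[OF \<open>ks \<in> K\<close> that] c[of _ q] that by (auto simp: ks0_def r_def)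
    then have "(\<Prod>q<r. \<Sum>a=1..Suc D. c q a * dcoeff a (ks ! q)) = (\<Prod>q<r. if ks ! q = ks0 ! q then 1 else 0)"
      by (intro prod.cong) auto
    also have "\<dots> = (if ks = ks0 then 1 else 0)"
      using that by (auto simp: list_eq_iff_nth_eq K_def relevant_modes_def ks0_def r_def intro!: prod_zero)
    finally show ?thesis .
  qed
  then have "(\<Sum>ks\<in>K. scaleF act (\<Prod>q<r. \<Sum>a=1..Suc D. c q a * dcoeff a (ks ! q)) (NO ks)) =
      (\<Sum>ks\<in>K. if ks = ks0 then NO ks0 else 0)"
    by (intro sum.cong) auto
  moreover have "ks0 \<in> K"
    by (auto simp: K_def relevant_modes_def ks0_def D_def r_def o_def uminus_sum_list_map o_def simp flip: sum_list_of_nat)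
  ultimately have "NO ks0 = (\<Sum>ks\<in>K. scaleF act (\<Prod>q<r. \<Sum>a=1..Suc D. c q a * dcoeff a (ks ! q)) (NO ks))"
    using finK by simp
  \<comment> \<open>Multiplying out the product of sums turns the choice of one weight per factor
    into a choice of v.\<close>
  also have "\<dots> = (\<Sum>ks\<in>K. \<Sum>\<alpha>\<in>E. scaleF act (\<Prod>q<r. c q (\<alpha> q) * dcoeff (\<alpha> q) (ks ! q)) (NO ks))"
    unfolding E_def by (simp only: prod_sum_PiE finite_lessThan finite_atLeastAtMost FS.scale_sum_left)
  also have "\<dots> = (\<Sum>\<alpha>\<in>E. scaleF act (\<Prod>q<r. c q (\<alpha> q)) (word_coeff act h (ws \<alpha>) (N \<alpha>) vac))"
    by (subst sum.swap) (simp add: coeff FS.scale_sum_right prod.distrib)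
  also have "\<dots> \<in> VU act h vac"
    using member unfolding VU_def by (intro FS.span_sum FS.span_scale)
  finally have "NO ks0 \<in> VU act h vac" .
  moreover have "zip (map fst ps) ks0 = map (\<lambda>x. (fst x, - int (snd x))) ps"
    unfolding ks0_def by (induction ps) auto
  ultimately show ?thesis
    using word_eq_normal_ordered[OF pos] by (simp add: NO_def ps_def)
qed

text \<open>Membership in \<open>VU\<close> is decided by this inclusion: charge 0 is
  enough.\<close>

lemma graded_part_VU: "graded_part 0 d a \<subseteq> VU act h vac"
proof -
  have "graded_words 0 d a \<subseteq> VU act h vac"
    by (auto simp: graded_words_def balanced_iff_charge o_def intro!: word_in_VU)
  then show ?thesis
    unfolding graded_part_def VU_def by (intro FS.span_minimal FS.subspace_span)
qed

lemma subspace_VU: "FS.subspace (VU act h vac)"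
  by (simp add: VU_def FS.subspace_span)

text \<open>Whichever modes are chosen, a balanced v contributes total charge 0, and the index n
  fixes the change of weight.\<close>

lemma word_coeff_in_VU:
  assumes "u \<in> graded_part 0 d a" "d \<ge> 0" "balanced (map fst ws)"
  shows "word_coeff act h ws n u \<in> VU act h vac \<inter> FS_weight (d + (\<Sum>x\<leftarrow>ws. int (snd x)) - n - 1)"
proof -
  let ?V = "VU act h vac \<inter> FS_weight (d + (\<Sum>x\<leftarrow>ws. int (snd x)) - n - 1)"
  have "FS.subspace ?V"
    by (intro FS.subspace_inter subspace_VU subspace_FS_weight)
  moreover have "normal_ordered h (zip (map fst ws) ks) u \<in> ?V"
    if "ks \<in> relevant_modes (length ws) d (n + 1 - (\<Sum>x\<leftarrow>ws. int (snd x)))" for ks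
  proof -
    let ?ps = "zip (map fst ws) ks"
    have ks: "length ks = length ws" "sum_list ks = n + 1 - (\<Sum>x\<leftarrow>ws. int (snd x))"
      using that by (auto simp: relevant_modes_def)
    have "(\<Sum>x\<leftarrow>?ps. charge (fst x)) = (\<Sum>i\<leftarrow>map fst ?ps. charge i)"
      by (simp only: map_map o_def)
    also have "\<dots> = (\<Sum>i\<leftarrow>map fst ws. charge i)"
      using ks(1) by simp
    finally have "normal_ordered h ?ps u \<in> graded_part 0 (d - sum_list ks) (a - (\<Sum>x\<leftarrow>?ps. sgn (snd x)))"
      using normal_ordered_graded[OF assms(1), of ?ps] assms(3) ks(1) by (simp add: balanced_iff_charge)
    then show ?thesis
      using subsetD[OF graded_part_VU] subsetD[OF graded_part_FS_weight] ks(2)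
      by (simp add: algebra_simps)
  qed
  ultimately show ?thesis
    unfolding word_coeff_graded_eq[OF assms(1,2)]
    by (intro FS.subspace_sum FS.subspace_scale)
qed

end

lemma FS_weight_negative: "d < 0 \<Longrightarrow> FS_weight d = {0}"
  by (force simp: FS_weight_def keys_eq_empty)

section \<open>Bijections and complete contractions\<close>

text \<open>Extensional functions, so that each bijection is counted once.\<close>

definition bijections :: "'a set \<Rightarrow> 'b set \<Rightarrow> ('a \<Rightarrow> 'b) set" where
  "bijections Q X = {\<beta> \<in> Q \<rightarrow>\<^sub>E X. bij_betw \<beta> Q X}"

lemma bijections_empty: "bijections {} {} = {\<lambda>_. undefined}"
  by (auto simp: bijections_def bij_betw_def)

lemma finite_bijections: "finite Q \<Longrightarrow> finite X \<Longrightarrow> finite (bijections Q X)"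
  unfolding bijections_def by (rule finite_subset[OF _ finite_PiE[of Q "\<lambda>_. X"]]) auto

text \<open>Sorting by the value x at q; for products this is the expansion of a permanent along the
  row \<open>q\<close>.\<close>

lemma sum_bijections_insert:
  assumes "q \<notin> Q" "finite Q" "finite X"
  shows "(\<Sum>\<beta>\<in>bijections (insert q Q) X. g \<beta>) = (\<Sum>x\<in>X. \<Sum>\<beta>\<in>bijections Q (X - {x}). g (\<beta>(q := x)))"
proof -
  have "(\<Sum>x\<in>X. \<Sum>\<beta>\<in>bijections Q (X - {x}). g (\<beta>(q := x))) =
      (\<Sum>(x, \<beta>)\<in>(SIGMA x:X. bijections Q (X - {x})). g (\<beta>(q := x)))"
    using assms by (intro sum.Sigma) (auto simp: finite_bijections)
  also have "\<dots> = (\<Sum>\<beta>\<in>bijections (insert q Q) X. g \<beta>)"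
  \<comment> \<open>Resetting q to \<open>undefined\<close> restores extensionality on
    \<open>Q\<close>.\<close>
  proof (rule sum.reindex_bij_witness[where i = "\<lambda>\<beta>. (\<beta> q, \<beta>(q := undefined))" and j = "\<lambda>(x, \<beta>). \<beta>(q := x)"])
    fix a assume "a \<in> (SIGMA x:X. bijections Q (X - {x}))"
    then obtain x \<beta> where a: "a = (x, \<beta>)" "x \<in> X" and \<beta>: "\<beta> \<in> Q \<rightarrow>\<^sub>E X - {x}" "bij_betw \<beta> Q (X - {x})"
      by (auto simp: bijections_def)
    have "\<beta> q = undefined" using assms(1) \<beta>(1) by (auto simp: PiE_def extensional_def)
    then show "((case a of (x, \<beta>) \<Rightarrow> \<beta>(q := x)) q, (case a of (x, \<beta>) \<Rightarrow> \<beta>(q := x))(q := undefined)) = a"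
      using fun_upd_triv[of \<beta> q] by (simp add: a)
    have "bij_betw (\<beta>(q := x)) Q (X - {x})"
      using \<beta>(2) assms(1) by (subst bij_betw_cong[where g = \<beta>]) auto
    then have "bij_betw (\<beta>(q := x)) (insert q Q) (insert x (X - {x}))"
      using notIn_Un_bij_betw[of q Q "\<beta>(q := x)" "X - {x}"] assms(1) by simp
    then show "(case a of (x, \<beta>) \<Rightarrow> \<beta>(q := x)) \<in> bijections (insert q Q) X"
      using \<beta>(1) a assms(1) by (auto simp: bijections_def insert_absorb PiE_def extensional_def split: if_splits)
    show "g (case a of (x, \<beta>) \<Rightarrow> \<beta>(q := x)) = (case a of (x, \<beta>) \<Rightarrow> g (\<beta>(q := x)))"
      by (simp add: a)
  next
    fix \<beta> assume "\<beta> \<in> bijections (insert q Q) X"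
    then have \<beta>: "\<beta> \<in> insert q Q \<rightarrow>\<^sub>E X" "bij_betw \<beta> (insert q Q) X" by (auto simp: bijections_def)
    have "bij_betw (\<beta>(q := undefined)) Q (X - {\<beta> q})"
      using \<beta>(2) assms(1) by (subst bij_betw_cong[where g = \<beta>]) (auto simp: bij_betw_def inj_on_def)
    moreover have "\<beta>(q := undefined) \<in> Q \<rightarrow>\<^sub>E X - {\<beta> q}"
      using calculation \<beta>(1) assms(1) by (auto simp: bij_betw_def PiE_def extensional_def)
    ultimately show "(\<beta> q, \<beta>(q := undefined)) \<in> (SIGMA x:X. bijections Q (X - {x}))"
      using \<beta>(1) by (auto simp: bijections_def)
  qed auto
  finally show ?thesis by simp
qed

text \<open>Read backwards, a decreasing tuple is the sorted list of its image, and that list is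
  determined by the image.\<close>

lemma bij_betw_decreasing_tuples:
  "bij_betw (\<lambda>c. c ` {1..k}) (decreasing_tuples k s) {C. C \<subseteq> {1..s} \<and> card C = k}"
proof -
  have sorted: "map c (rev [1..<Suc k]) = sorted_list_of_set (c ` {1..k})" if "c \<in> decreasing_tuples k s" for c
  proof -
    have "sorted_wrt (\<lambda>x y. c y < c x) [1..<Suc k]"
      by (rule sorted_wrt_mono_rel[OF _ sorted_wrt_upt])
        (use that in \<open>auto simp: decreasing_tuples_def simp del: upt_Suc\<close>)
    then have "sorted_wrt (<) (map c (rev [1..<Suc k]))"
      by (simp only: sorted_wrt_map sorted_wrt_rev)
    then show ?thesis
      by (intro strict_sorted_equal strict_sorted_list_of_set) (simp_all add: atLeastLessThanSuc_atLeastAtMost del: upt_Suc)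
  qed
  show ?thesis
  proof (rule bij_betw_imageI)
    show "inj_on (\<lambda>c. c ` {1..k}) (decreasing_tuples k s)"
    proof (rule inj_onI)
      fix c c' assume *: "c \<in> decreasing_tuples k s" "c' \<in> decreasing_tuples k s" "c ` {1..k} = c' ` {1..k}"
      then have "map c (rev [1..<Suc k]) = map c' (rev [1..<Suc k])" by (simp only: sorted)
      then have "\<forall>q\<in>{1..k}. c q = c' q" by (auto simp del: upt_Suc)
      then show "c = c'"
        using * by (auto simp: decreasing_tuples_def intro: PiE_ext)
    qed
    show "(\<lambda>c. c ` {1..k}) ` decreasing_tuples k s = {C. C \<subseteq> {1..s} \<and> card C = k}"
    proof (intro equalityI subsetI)
      fix C assume "C \<in> (\<lambda>c. c ` {1..k}) ` decreasing_tuples k s"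
      then obtain c where c: "c \<in> decreasing_tuples k s" "C = c ` {1..k}" by blast
      have "distinct (map c (rev [1..<Suc k]))" by (simp only: sorted[OF c(1)] distinct_sorted_list_of_set)
      then have "inj_on c {1..k}" by (simp add: distinct_map atLeastLessThanSuc_atLeastAtMost del: upt_Suc)
      then show "C \<in> {C. C \<subseteq> {1..s} \<and> card C = k}"
        using c by (auto simp: decreasing_tuples_def card_image)
    next
      fix C assume "C \<in> {C. C \<subseteq> {1..s} \<and> card C = k}"
      then have C: "C \<subseteq> {1..s}" "card C = k" "finite C" by (auto intro: finite_subset)
      let ?L = "sorted_list_of_set C"
      have L: "length ?L = k" "set ?L = C" using C by simp_all
      \<comment> \<open>Position \<open>k - q\<close> makes c 1 the last, hence largest, entry of
        the sorted list.\<close>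
      define c where "c = (\<lambda>q\<in>{1..k}. ?L ! (k - q))"
      have "c ` {1..k} = C"
      proof -
        have "c ` {1..k} = (!) ?L ` ((\<lambda>q. k - q) ` {1..k})" by (auto simp: c_def image_image)
        also have "(\<lambda>q. k - q) ` {1..k} = {..<k}"
        proof (intro equalityI subsetI)
          fix x assume "x \<in> {..<k}"
          then show "x \<in> (\<lambda>q. k - q) ` {1..k}" by (intro image_eqI[of _ _ "k - x"]) auto
        qed auto
        also have "(!) ?L ` {..<k} = set ?L"
          by (auto simp: set_conv_nth C(2))
        finally show ?thesis using L(2) by simp
      qed
      moreover have "c \<in> decreasing_tuples k s"
        unfolding decreasing_tuples_def
      proof (intro CollectI conjI ballI impI)
        show "c \<in> {1..k} \<rightarrow>\<^sub>E {1..s}"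
          using \<open>c ` {1..k} = C\<close> C(1) by (auto simp: c_def)
        fix a b assume "a \<in> {1..k}" "b \<in> {1..k}" "a < b"
        then show "c b < c a"
          using sorted_wrt_nth_less[OF strict_sorted_list_of_set, of "k - b" "k - a" C] L by (auto simp: c_def)
      qed
      ultimately show "C \<in> (\<lambda>c. c ` {1..k}) ` decreasing_tuples k s" by blast
    qed
  qed
qed

lemma decreasing_tuple_bij_betw:
  assumes "c \<in> decreasing_tuples k s"
  shows "bij_betw c {1..k} (c ` {1..k})"
proof -
  have "c a \<noteq> c b" if "a \<in> {1..k}" "b \<in> {1..k}" "a \<noteq> b" for a b
    using assms that by (cases a b rule: linorder_cases) (fastforce simp: decreasing_tuples_def)+
  then show ?thesis unfolding bij_betw_def inj_on_def by blast
qed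

text \<open>The correspondence is composition with c. A permutation in the sense of
  \<open>permutes\<close> fixes everything outside \<open>A\<close>, whence the identity branch in
  one direction and \<open>restrict\<close> in the other.\<close>

lemma sum_bijections_permutations:
  assumes c: "bij_betw c A C"
  shows "(\<Sum>\<beta>\<in>bijections C A. g \<beta>) = (\<Sum>\<sigma> | \<sigma> permutes A. g (restrict (\<sigma> \<circ> inv_into A c) C))"
proof (rule sum.reindex_bij_witness[where i = "\<lambda>\<sigma>. restrict (\<sigma> \<circ> inv_into A c) C"
      and j = "\<lambda>\<beta> q. if q \<in> A then \<beta> (c q) else q"])
  have inv: "inv_into A c x \<in> A" "c (inv_into A c x) = x" if "x \<in> C" for x
    using c that by (auto simp: bij_betw_def inv_into_into f_inv_into_f)
  have inv': "inv_into A c (c q) = q" "c q \<in> C" if "q \<in> A" for q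
    using c that by (auto simp: bij_betw_def)
  fix \<beta> assume "\<beta> \<in> bijections C A"
  then have \<beta>: "\<beta> \<in> C \<rightarrow>\<^sub>E A" "bij_betw \<beta> C A" by (auto simp: bijections_def)
  show *: "restrict ((\<lambda>q. if q \<in> A then \<beta> (c q) else q) \<circ> inv_into A c) C = \<beta>"
    using \<beta>(1) inv by (auto simp: fun_eq_iff restrict_def PiE_def extensional_def)
  have "bij_betw (\<beta> \<circ> c) A A" using bij_betw_trans[OF c \<beta>(2)] .
  then have "bij_betw (\<lambda>q. if q \<in> A then \<beta> (c q) else q) A A"
    by (rule iffD1[OF bij_betw_cong, rotated]) simp
  then show "(\<lambda>q. if q \<in> A then \<beta> (c q) else q) \<in> {\<sigma>. \<sigma> permutes A}"
    by (auto intro: bij_imp_permutes)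
  show "g (restrict ((\<lambda>q. if q \<in> A then \<beta> (c q) else q) \<circ> inv_into A c) C) = g \<beta>"
    by (simp only: *)
next
  fix \<sigma> assume "\<sigma> \<in> {\<sigma>. \<sigma> permutes A}"
  then have \<sigma>: "\<sigma> permutes A" by simp
  show "(\<lambda>q. if q \<in> A then restrict (\<sigma> \<circ> inv_into A c) C (c q) else q) = \<sigma>"
    using c permutes_not_in[OF \<sigma>] by (auto simp: fun_eq_iff bij_betw_def)
  have "bij_betw (\<sigma> \<circ> inv_into A c) C A"
    by (rule bij_betw_trans[OF bij_betw_inv_into[OF c] permutes_imp_bij[OF \<sigma>]])
  then have "bij_betw (restrict (\<sigma> \<circ> inv_into A c) C) C A"
    by (rule iffD1[OF bij_betw_cong, rotated]) simp
  then show "restrict (\<sigma> \<circ> inv_into A c) C \<in> bijections C A"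
    by (auto simp: bijections_def bij_betw_def)
qed

section \<open>Contracting positive modes against a word\<close>

context heisenberg_modes
begin

text \<open>A positive mode acts like a derivation that kills words without letters: one term for
  each letter it can contract. Distinct indices \<open>xs\<close> keep equal letters apart.\<close>

lemma positive_mode_indexed_word:
  assumes "n > 0" "distinct xs" "\<forall>x\<in>set xs. t x > 0"
  shows "h i (int n) (word (map (\<lambda>x. (j x, t x)) xs) B) = (\<Sum>x\<in>set xs.
    scaleF act (if n = t x then of_nat n * bracket i (j x) * l else 0) (word (map (\<lambda>x. (j x, t x)) (remove1 x xs)) B))"
  using assms(2,3)
proof (induction xs)
  case Nil
  then show ?case using assms(1) by (simp add: positive_mode_word_Nil)
next
  case (Cons y xs)
  have "remove1 x (y # xs) = y # remove1 x xs" if "x \<in> set xs" for x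
    using Cons.prems that by auto
  then have "(\<Sum>x\<in>set xs. scaleF act (if n = t x then of_nat n * bracket i (j x) * l else 0) (word (map (\<lambda>x. (j x, t x)) (remove1 x (y # xs))) B))
    = h (j y) (- int (t y)) (h i (int n) (word (map (\<lambda>x. (j x, t x)) xs) B))"
    using Cons by (auto simp: mode.sum mode.scale word_Cons intro!: sum.cong)
  then show ?case
    using Cons.prems positive_mode_word_Cons[OF assms(1), of "t y" i "j y"] by (simp add: add.commute)
qed

lemma foldr_mode_sum:
  "foldr (\<lambda>q. h (i q) (\<kappa> q)) qs (\<Sum>x\<in>X. scaleF act (c x) (\<phi> x)) =
    (\<Sum>x\<in>X. scaleF act (c x) (foldr (\<lambda>q. h (i q) (\<kappa> q)) qs (\<phi> x)))"
  by (induction qs) (simp_all add: mode.sum mode.scale)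

text \<open>As many positive modes as letters leave no letter. The last mode of \<open>qs\<close>
  acts first, hence the reverse induction; choosing its partner is the row expansion of a permanent,
  which depends on the index sets but not on their order.\<close>

lemma positive_modes_indexed_word:
  assumes "distinct qs" "\<forall>q\<in>set qs. \<kappa> q > 0" "distinct xs" "\<forall>x\<in>set xs. t x > 0" "length qs = length xs"
  shows "foldr (\<lambda>q. h (i q) (int (\<kappa> q))) qs (word (map (\<lambda>x. (j x, t x)) xs) B) =
    scaleF act (\<Sum>\<beta>\<in>bijections (set qs) (set xs). \<Prod>q\<in>set qs.
      if \<kappa> q = t (\<beta> q) then of_nat (\<kappa> q) * bracket (i q) (j (\<beta> q)) * l else 0) (word [] B)"
  using assms
proof (induction qs arbitrary: xs rule: rev_induct)
  case Nil
  then show ?case by (simp add: bijections_empty)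
next
  case (snoc q qs)
  let ?c = "\<lambda>q x. if \<kappa> q = t x then of_nat (\<kappa> q) * bracket (i q) (j x) * l else 0 :: complex"
  let ?S = "\<lambda>X. \<Sum>\<beta>\<in>bijections (set qs) X. \<Prod>q\<in>set qs. ?c q (\<beta> q)"
  have q: "q \<notin> set qs" using snoc.prems by auto
  have "foldr (\<lambda>q. h (i q) (int (\<kappa> q))) (qs @ [q]) (word (map (\<lambda>x. (j x, t x)) xs) B) =
    foldr (\<lambda>q. h (i q) (int (\<kappa> q))) qs (\<Sum>x\<in>set xs. scaleF act (?c q x) (word (map (\<lambda>x. (j x, t x)) (remove1 x xs)) B))"
    using snoc.prems by (simp add: positive_mode_indexed_word)
  also have "\<dots> = (\<Sum>x\<in>set xs. scaleF act (?c q x) (foldr (\<lambda>q. h (i q) (int (\<kappa> q))) qs (word (map (\<lambda>x. (j x, t x)) (remove1 x xs)) B)))"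
    by (rule foldr_mode_sum)
  also have "\<dots> = (\<Sum>x\<in>set xs. scaleF act (?c q x) (scaleF act (?S (set xs - {x})) (word [] B)))"
  proof (intro sum.cong refl arg_cong[where f = "scaleF act _"])
    fix x assume "x \<in> set xs"
    then show "foldr (\<lambda>q. h (i q) (int (\<kappa> q))) qs (word (map (\<lambda>x. (j x, t x)) (remove1 x xs)) B) =
      scaleF act (?S (set xs - {x})) (word [] B)"
      using snoc.prems snoc.IH[of "remove1 x xs"] by (auto simp: length_remove1)
  qed
  also have "\<dots> = scaleF act (\<Sum>x\<in>set xs. ?c q x * ?S (set xs - {x})) (word [] B)"
    unfolding FS.scale_scale by (rule FS.scale_sum_left[symmetric])
  also have "(\<Sum>x\<in>set xs. ?c q x * ?S (set xs - {x})) =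
    (\<Sum>\<beta>\<in>bijections (insert q (set qs)) (set xs). \<Prod>q\<in>insert q (set qs). ?c q (\<beta> q))"
  proof -
    have "?c q x * (\<Prod>q\<in>set qs. ?c q (\<beta> q)) = (\<Prod>q'\<in>insert q (set qs). ?c q' ((\<beta>(q := x)) q'))" for x \<beta>
    proof -
      have "(\<Prod>q'\<in>set qs. ?c q' ((\<beta>(q := x)) q')) = (\<Prod>q'\<in>set qs. ?c q' (\<beta> q'))"
        using q by (intro prod.cong) auto
      then show ?thesis using q by simp
    qed
    then show ?thesis
      by (subst sum_bijections_insert[OF q]) (simp_all only: sum_distrib_left finite_set)
  qed
  finally show ?case by simp
qed

end

section \<open>The lowest weight component\<close>

lemma prod_if_zero:
  fixes g :: "'a \<Rightarrow> 'b::comm_semiring_1"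
  assumes "finite A"
  shows "(\<Prod>x\<in>A. if P x then g x else 0) = (if \<forall>x\<in>A. P x then \<Prod>x\<in>A. g x else 0)"
  using assms by (induction A) auto

text \<open>The factor of an uncontracted position, whose mode is 0; it yields the signs in the
  formula, as \<open>dcoeff_of_nat\<close> yields the factor of a contracted one.\<close>

lemma dcoeff_zero: "m > 0 \<Longrightarrow> dcoeff m 0 = (- 1) ^ (m - 1)"
proof -
  have "(\<Prod>q<N. (- 1 - of_nat q :: complex)) = (- 1) ^ N * fact N" for N
    by (induction N) (simp_all add: algebra_simps)
  then show ?thesis by (simp add: dcoeff_def)
qed

lemma dcoeff_of_nat: "dcoeff m (int t) = (\<Prod>b=1..m - 1. - of_nat t - of_nat b) / fact (m - 1)"
  by (simp add: dcoeff_def prod.atLeast1_atMost_eq algebra_simps)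

context heisenberg_modes
begin

text \<open>For fixed modes \<open>\<kappa>\<close> only the set of positions with positive mode can
  serve as \<open>C\<close>. The sum over all \<open>C\<close> and \<open>\<beta>\<close> is written
  nevertheless, because its index set does not depend on \<open>\<kappa>\<close> and can later be
  exchanged with the sum over modes.\<close>

lemma normal_ordered_indexed_word:
  fixes i j :: "nat \<Rightarrow> pm" and t :: "nat \<Rightarrow> nat" and \<kappa> :: "nat \<Rightarrow> int"
  assumes t: "\<forall>q\<in>{1..k}. t q > 0" and sum: "(\<Sum>q=1..s. \<kappa> q) = int (\<Sum>q=1..k. t q)"
  shows "normal_ordered h (map (\<lambda>q. (i q, \<kappa> q)) [1..<Suc s]) (word (map (\<lambda>q. (j q, t q)) [1..<Suc k]) B) =
    (\<Sum>C | C \<subseteq> {1..s} \<and> card C = k. \<Sum>\<beta>\<in>bijections C {1..k}.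
      if \<forall>q\<in>{1..s}. \<kappa> q = (if q \<in> C then int (t (\<beta> q)) else 0)
      then scaleF act (\<Prod>q\<in>C. of_nat (t (\<beta> q)) * l * bracket (i q) (j (\<beta> q)))
        (zero_word (map i (filter (\<lambda>q. q \<notin> C) [1..<Suc s]) @ B))
      else 0)"
    (is "?L = (\<Sum>C | C \<subseteq> {1..s} \<and> card C = k. \<Sum>\<beta>\<in>bijections C {1..k}. ?R C \<beta>)")
proof -
  let ?ps = "map (\<lambda>q. (i q, \<kappa> q)) [1..<Suc s]"
  let ?A = "map (\<lambda>q. (j q, t q)) [1..<Suc k]"
  define P where "P = {q\<in>{1..s}. \<kappa> q > 0}"
  define N where "N = {q\<in>{1..s}. \<kappa> q < 0}"
  have fin: "finite P" "finite N" by (simp_all add: P_def N_def)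
  have set_upt: "set [1..<Suc a] = {1..a}" for a by (simp add: atLeastLessThanSuc_atLeastAtMost del: upt_Suc One_nat_def)
  have posA: "\<forall>x\<in>set ?A. snd x > 0" using t by (auto simp: set_upt simp del: upt_Suc One_nat_def)
  have list_sum: "(\<Sum>q\<leftarrow>[1..<Suc a]. g q) = (\<Sum>q=1..a. g q)" for g :: "nat \<Rightarrow> int" and a
    by (simp only: interv_sum_list_conv_sum_set_nat set_upt)
  obtain \<delta> where graded: "word ?A B \<in> graded_part \<delta> (\<Sum>q=1..k. int (t q)) (int k)"
    using word_in_graded_part[OF posA refl, of "\<Sum>q=1..k. int (t q)" "int k" B]
    by (simp add: o_def list_sum del: upt_Suc One_nat_def)
  have matched: "P = C \<and> N = {}"
    if "C \<subseteq> {1..s}" "\<beta> \<in> bijections C {1..k}" "\<forall>q\<in>{1..s}. \<kappa> q = (if q \<in> C then int (t (\<beta> q)) else 0)" for C \<beta>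
  proof -
    have "t (\<beta> q) > 0" if "q \<in> C" for q
      using \<open>\<beta> \<in> bijections C {1..k}\<close> that t unfolding bijections_def by blast
    then have "\<kappa> q > 0 \<longleftrightarrow> q \<in> C" "\<not> \<kappa> q < 0" if "q \<in> {1..s}" for q
      using that(1) \<open>\<forall>q\<in>{1..s}. \<kappa> q = _ q\<close> by simp_all
    then show ?thesis using \<open>C \<subseteq> {1..s}\<close> unfolding P_def N_def by blast
  qed
  show ?thesis
  proof (cases "N = {} \<and> card P = k")
    case False
    have "?L = 0"
    proof (cases "card P > k")
      case True
      \<comment> \<open>More than \<open>k\<close> positive modes act on only \<open>k\<close>
        letters, and before any negative mode: the count drops below 0.\<close>
      let ?P = "filter (\<lambda>x. snd x > 0) ?ps" and ?Z = "filter (\<lambda>x. snd x = 0) ?ps"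
      have "(\<Sum>x\<leftarrow>xs. sgn (snd x)) = int (length xs)" if "\<forall>x\<in>set xs. snd x > 0" for xs :: "(pm \<times> int) list"
        using that by (induction xs) auto
      then have "(\<Sum>x\<leftarrow>?P. sgn (snd x)) = int (length ?P)" by simp
      also have "length ?P = card (set (filter (\<lambda>q. \<kappa> q > 0) [1..<Suc s]))"
        by (subst distinct_card) (simp_all add: filter_map o_def del: upt_Suc)
      also have "set (filter (\<lambda>q. \<kappa> q > 0) [1..<Suc s]) = P"
        by (auto simp: set_upt P_def simp del: upt_Suc One_nat_def)
      finally have "(\<Sum>x\<leftarrow>?P. sgn (snd x)) = int (card P)" .
      moreover have "(\<Sum>x\<leftarrow>xs. sgn (snd x)) = 0" if "\<forall>x\<in>set xs. snd x = 0" for xs :: "(pm \<times> int) list"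
        using that by (induction xs) auto
      then have "(\<Sum>x\<leftarrow>?Z. sgn (snd x)) = 0" by simp
      ultimately have "foldr (\<lambda>(i, n). h i n) (?P @ ?Z) (word ?A B) = 0"
        using modes_graded[OF graded, of "?P @ ?Z"] True
        by (simp add: graded_part_trivial del: upt_Suc One_nat_def foldr_append)
      then show ?thesis by (simp add: normal_ordered_def foldr_mode_zero del: upt_Suc One_nat_def)
    next
      case False
      \<comment> \<open>Here there are fewer than \<open>k\<close> positive modes, or exactly
        \<open>k\<close> together with a negative one. Letters remain in either case, while the
        total of the modes brings the weight to 0.\<close>
      have "(\<Sum>q=1..s. sgn (\<kappa> q)) = (\<Sum>q=1..s. if \<kappa> q > 0 then 1 else 0) - (\<Sum>q=1..s. if \<kappa> q < 0 then 1 else 0)"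
        by (simp flip: sum_subtractf) (auto intro!: sum.cong)
      also have "\<dots> = int (card P) - int (card N)"
        by (simp add: P_def N_def flip: sum.inter_filter)
      finally have "(\<Sum>q=1..s. sgn (\<kappa> q)) < int k"
        using False \<open>\<not> (N = {} \<and> card P = k)\<close> fin card_gt_0_iff[of N] by auto
      then show ?thesis
        using normal_ordered_graded[OF graded, of ?ps] sum
        by (simp add: o_def list_sum graded_part_trivial del: upt_Suc One_nat_def)
    qed
    moreover have "(\<Sum>C | C \<subseteq> {1..s} \<and> card C = k. \<Sum>\<beta>\<in>bijections C {1..k}. ?R C \<beta>) = 0"
      using matched False by (intro sum.neutral ballI) (auto simp del: upt_Suc One_nat_def)
    ultimately show ?thesis by simp
  next
    case True
    then have nonneg: "\<kappa> q \<ge> 0" if "q \<in> {1..s}" for q using that by (auto simp: N_def not_less)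
    define QP where "QP = filter (\<lambda>q. q \<in> P) [1..<Suc s]"
    define QZ where "QZ = filter (\<lambda>q. q \<notin> P) [1..<Suc s]"
    have QP: "set QP = P" "distinct QP" "length QP = k"
    proof -
      show "set QP = P" "distinct QP" by (auto simp: QP_def P_def set_upt simp del: upt_Suc One_nat_def)
      then show "length QP = k" using True by (metis distinct_card)
    qed
    have sign: "\<kappa> q < 0 \<longleftrightarrow> False" "\<kappa> q > 0 \<longleftrightarrow> q \<in> P" "\<kappa> q = 0 \<longleftrightarrow> q \<notin> P" if "q \<in> set [1..<Suc s]" for q
    proof -
      have "q \<in> {1..s}" using that unfolding set_upt .
      then show "\<kappa> q < 0 \<longleftrightarrow> False" "\<kappa> q > 0 \<longleftrightarrow> q \<in> P" "\<kappa> q = 0 \<longleftrightarrow> q \<notin> P"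
        using nonneg[of q] by (auto simp: P_def simp del: One_nat_def)
    qed
    have "filter (\<lambda>q. \<kappa> q < 0) [1..<Suc s] = []" "filter (\<lambda>q. \<kappa> q > 0) [1..<Suc s] = QP"
      "filter (\<lambda>q. \<kappa> q = 0) [1..<Suc s] = QZ"
      unfolding QP_def QZ_def by (simp_all only: sign cong: filter_cong) simp
    then have "?L = foldr (\<lambda>q. h (i q) (\<kappa> q)) QP (foldr (\<lambda>q. h (i q) (\<kappa> q)) QZ (word ?A B))"
      by (simp add: normal_ordered_def filter_map o_def foldr_map del: upt_Suc One_nat_def)
    also have "foldr (\<lambda>q. h (i q) (\<kappa> q)) QZ (word ?A B) = foldr (\<lambda>q. h (i q) 0) QZ (word ?A B)"
    proof -
      have "\<kappa> q = 0" if "q \<in> set QZ" for q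
        using that sign(3)[of q] by (simp add: QZ_def del: upt_Suc)
      then show ?thesis by (intro foldr_cong) simp_all
    qed
    \<comment> \<open>Zero modes pass all letters and join \<open>B\<close> from the left, which
      fixes the order of the surviving factors.\<close>
    also have "\<dots> = word ?A (map i QZ @ B)"
    proof -
      have "foldr (\<lambda>q. h (i q) 0) qs (word ?A B) = word ?A (map i qs @ B)" for qs
        by (induction qs) (simp_all add: zero_mode_word[OF posA] del: upt_Suc One_nat_def)
      then show ?thesis .
    qed
    also have "foldr (\<lambda>q. h (i q) (\<kappa> q)) QP \<dots> = foldr (\<lambda>q. h (i q) (int (nat (\<kappa> q)))) QP \<dots>"
      by (intro foldr_cong) (auto simp: QP P_def)
    also have "\<dots> = scaleF act (\<Sum>\<beta>\<in>bijections P {1..k}. \<Prod>q\<in>P.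
      if nat (\<kappa> q) = t (\<beta> q) then of_nat (nat (\<kappa> q)) * bracket (i q) (j (\<beta> q)) * l else 0) (word [] (map i QZ @ B))"
      using positive_modes_indexed_word[of QP "\<lambda>q. nat (\<kappa> q)" "[1..<Suc k]" t i j "map i QZ @ B"] QP t
      unfolding set_upt by (simp add: P_def del: upt_Suc One_nat_def)
    also have "\<dots> = (\<Sum>\<beta>\<in>bijections P {1..k}. ?R P \<beta>)"
      unfolding FS.scale_sum_left
    proof (rule sum.cong[OF refl])
      fix \<beta> assume "\<beta> \<in> bijections P {1..k}"
      have "(\<forall>q\<in>P. nat (\<kappa> q) = t (\<beta> q)) \<longleftrightarrow> (\<forall>q\<in>{1..s}. \<kappa> q = (if q \<in> P then int (t (\<beta> q)) else 0))"
      proof -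
        have "\<kappa> q = (if q \<in> P then int (t (\<beta> q)) else 0) \<longleftrightarrow> (q \<in> P \<longrightarrow> nat (\<kappa> q) = t (\<beta> q))"
          if "q \<in> {1..s}" for q
          using nonneg[OF that] that by (auto simp: P_def)
        moreover have "P \<subseteq> {1..s}" by (auto simp: P_def)
        ultimately show ?thesis by blast
      qed
      moreover have "(\<Prod>q\<in>P. of_nat (nat (\<kappa> q)) * bracket (i q) (j (\<beta> q)) * l) =
          (\<Prod>q\<in>P. of_nat (t (\<beta> q)) * l * bracket (i q) (j (\<beta> q)))"
        if "\<forall>q\<in>P. nat (\<kappa> q) = t (\<beta> q)"
        using that by (intro prod.cong) auto
      ultimately show "scaleF act (\<Prod>q\<in>P. if nat (\<kappa> q) = t (\<beta> q) then of_nat (nat (\<kappa> q)) * bracket (i q) (j (\<beta> q)) * l else 0)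
        (word [] (map i QZ @ B)) = ?R P \<beta>"
        by (simp add: prod_if_zero fin word_Nil QZ_def del: upt_Suc One_nat_def)
    qed
    also have "\<dots> = (\<Sum>C | C \<subseteq> {1..s} \<and> card C = k. if C = P then \<Sum>\<beta>\<in>bijections P {1..k}. ?R P \<beta> else 0)"
      using True by (subst sum.delta) (auto simp: P_def simp del: upt_Suc One_nat_def)
    also have "\<dots> = (\<Sum>C | C \<subseteq> {1..s} \<and> card C = k. \<Sum>\<beta>\<in>bijections C {1..k}. ?R C \<beta>)"
    proof (rule sum.cong[OF refl])
      fix C assume "C \<in> {C. C \<subseteq> {1..s} \<and> card C = k}"
      then have C: "C \<subseteq> {1..s}" by blast
      have zero: "?R C \<beta> = 0" if "\<beta> \<in> bijections C {1..k}" "C \<noteq> P" for \<beta>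
        by (rule if_not_P) (use matched[OF C that(1)] that(2) in blast)
      then show "(if C = P then \<Sum>\<beta>\<in>bijections P {1..k}. ?R P \<beta> else 0) = (\<Sum>\<beta>\<in>bijections C {1..k}. ?R C \<beta>)"
      proof (cases "C = P")
        case True
        show ?thesis by (simp only: True simp_thms if_True)
      next
        case False
        have "(\<Sum>\<beta>\<in>bijections C {1..k}. ?R C \<beta>) = 0"
          by (intro sum.neutral ballI zero False)
        then show ?thesis by (simp only: False if_False)
      qed
    qed
    finally show ?thesis .
  qed
qed

lemma word_coeff_lowest:
  fixes i j :: "nat \<Rightarrow> pm" and t m :: "nat \<Rightarrow> nat"
  assumes t: "\<forall>q\<in>{1..k}. t q > 0" and m: "\<forall>q\<in>{1..s}. m q > 0"
  shows "word_coeff act h (map (\<lambda>q. (i q, m q)) [1..<Suc s]) (int (\<Sum>q=1..s. m q) + int (\<Sum>q=1..k. t q) - 1)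
      (word (map (\<lambda>q. (j q, t q)) [1..<Suc k]) B) =
    (\<Sum>c\<in>decreasing_tuples k s. \<Sum>\<sigma> | \<sigma> permutes {1..k}.
      scaleF act
        ((\<Prod>q\<in>{1..s} - c ` {1..k}. (- 1) ^ (m q - 1))
         * (\<Prod>q=1..k. (\<Prod>b=1..m (c q) - 1. - of_nat (t (\<sigma> q)) - of_nat b) / fact (m (c q) - 1))
         * (\<Prod>q=1..k. of_nat (t (\<sigma> q)) * l * bracket (i (c q)) (j (\<sigma> q))))
        (zero_word (map i (filter (\<lambda>q. q \<notin> c ` {1..k}) [1..<Suc s]) @ B)))"
proof -
  let ?ws = "map (\<lambda>q. (i q, m q)) [1..<Suc s]"
  let ?A = "map (\<lambda>q. (j q, t q)) [1..<Suc k]"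
  define D where "D = (\<Sum>q=1..k. int (t q))"
  \<comment> \<open>A factor in \<open>C\<close> has to take the mode matching its partner
    \<open>\<beta> q\<close>; every other factor takes the zero mode.\<close>
  define \<kappa> where "\<kappa> C \<beta> q = (if q \<in> C then int (t (\<beta> q)) else 0)" for C :: "nat set" and \<beta> and q :: nat
  define Z where "Z C = zero_word (map i (filter (\<lambda>q. q \<notin> C) [1..<Suc s]) @ B)" for C
  define b where "b C \<beta> = (\<Prod>q\<in>C. of_nat (t (\<beta> q)) * l * bracket (i q) (j (\<beta> q)))" for C and \<beta> :: "nat \<Rightarrow> nat"
  \<comment> \<open>\<open>D\<close>, the weight of the word, appears twice: no mode may exceed it,
    and the index of the coefficient is such that the modes add up to it.\<close>
  define K where "K = relevant_modes s D D"
  define \<C> where "\<C> = {C. C \<subseteq> {1..s} \<and> card C = k}"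
  define R where "R C \<beta> = scaleF act ((\<Prod>q\<in>{1..s}. dcoeff (m q) (\<kappa> C \<beta> q)) * b C \<beta>) (Z C)" for C \<beta>
  have set_upt: "set [1..<Suc a] = {1..a}" for a by (simp add: atLeastLessThanSuc_atLeastAtMost del: upt_Suc One_nat_def)
  have list_sum: "(\<Sum>q\<leftarrow>[1..<Suc a]. g q) = (\<Sum>q=1..a. g q)" for g :: "nat \<Rightarrow> int" and a
    by (simp only: interv_sum_list_conv_sum_set_nat set_upt)
  have posA: "\<forall>x\<in>set ?A. snd x > 0" using t by (auto simp: set_upt simp del: upt_Suc One_nat_def)
  obtain \<delta> where graded: "word ?A B \<in> graded_part \<delta> D (int k)"
    using word_in_graded_part[OF posA refl, of D "int k" B]
    by (simp add: o_def list_sum D_def del: upt_Suc One_nat_def)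
  have "D \<ge> 0" by (simp add: D_def sum_nonneg)
  \<comment> \<open>Lists of modes start at position 0, factors and letters at 1.\<close>
  have nth_eq: "ks = map (\<lambda>q. ks ! (q - 1)) [1..<Suc s]" if "length ks = s" for ks :: "int list"
    using that by (intro nth_equalityI) (simp_all del: upt_Suc One_nat_def)
  have ks_eq_iff: "ks = map g [1..<Suc s] \<longleftrightarrow> (\<forall>q\<in>{1..s}. ks ! (q - 1) = g q)" if "length ks = s" for g and ks :: "int list"
    by (subst nth_eq[OF that]) (auto simp: set_upt simp del: upt_Suc One_nat_def)
  have "word_coeff act h ?ws (int (\<Sum>q=1..s. m q) + int (\<Sum>q=1..k. t q) - 1) (word ?A B) =
    (\<Sum>ks\<in>K. scaleF act (\<Prod>q<s. dcoeff (m (Suc q)) (ks ! q)) (normal_ordered h (zip (map fst ?ws) ks) (word ?A B)))"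
    by (subst word_coeff_graded_eq[OF graded \<open>D \<ge> 0\<close>])
      (simp add: o_def list_sum K_def D_def del: upt_Suc One_nat_def flip: Suc_eq_plus1_left)
  also have "\<dots> = (\<Sum>ks\<in>K. \<Sum>C\<in>\<C>. \<Sum>\<beta>\<in>bijections C {1..k}. if ks = map (\<kappa> C \<beta>) [1..<Suc s] then R C \<beta> else 0)"
  proof (rule sum.cong[OF refl])
    fix ks assume "ks \<in> K"
    then have ks: "length ks = s" "sum_list ks = D" by (auto simp: K_def relevant_modes_def)
    have "zip (map fst ?ws) ks = map (\<lambda>q. (i q, ks ! (q - 1))) [1..<Suc s]"
      using ks(1) by (intro nth_equalityI) (simp_all del: upt_Suc One_nat_def)
    moreover have "(\<Sum>q=1..s. ks ! (q - 1)) = int (\<Sum>q=1..k. t q)"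
      using ks(2) nth_eq[OF ks(1)] list_sum[of "\<lambda>q. ks ! (q - 1)" s] by (simp add: D_def del: upt_Suc One_nat_def)
    ultimately have NO: "normal_ordered h (zip (map fst ?ws) ks) (word ?A B) = (\<Sum>C\<in>\<C>. \<Sum>\<beta>\<in>bijections C {1..k}.
      if ks = map (\<kappa> C \<beta>) [1..<Suc s] then scaleF act (b C \<beta>) (Z C) else 0)"
      by (simp only: normal_ordered_indexed_word[OF t] \<C>_def \<kappa>_def b_def Z_def ks_eq_iff[OF ks(1)])
    have "(\<Prod>q<s. dcoeff (m (Suc q)) (ks ! q)) = (\<Prod>q\<in>{1..s}. dcoeff (m q) (\<kappa> C \<beta> q))"
      if "ks = map (\<kappa> C \<beta>) [1..<Suc s]" for C \<beta>
    proof -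
      have "(\<Prod>q<s. dcoeff (m (Suc q)) (ks ! q)) = (\<Prod>q\<in>{1..s}. dcoeff (m q) (ks ! (q - 1)))"
        by (simp add: prod.atLeast1_atMost_eq)
      also have "\<dots> = (\<Prod>q\<in>{1..s}. dcoeff (m q) (\<kappa> C \<beta> q))"
        using that unfolding ks_eq_iff[OF ks(1)] by (intro prod.cong) auto
      finally show ?thesis .
    qed
    then show "scaleF act (\<Prod>q<s. dcoeff (m (Suc q)) (ks ! q)) (normal_ordered h (zip (map fst ?ws) ks) (word ?A B)) =
      (\<Sum>C\<in>\<C>. \<Sum>\<beta>\<in>bijections C {1..k}. if ks = map (\<kappa> C \<beta>) [1..<Suc s] then R C \<beta> else 0)"
      unfolding NO FS.scale_sum_right by (intro sum.cong refl) (simp add: R_def del: upt_Suc One_nat_def)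
  qed
  also have "\<dots> = (\<Sum>C\<in>\<C>. \<Sum>\<beta>\<in>bijections C {1..k}. \<Sum>ks\<in>K. if ks = map (\<kappa> C \<beta>) [1..<Suc s] then R C \<beta> else 0)"
    by (subst sum.swap) (intro sum.cong refl sum.swap)
  also have "\<dots> = (\<Sum>C\<in>\<C>. \<Sum>\<beta>\<in>bijections C {1..k}. R C \<beta>)"
  \<comment> \<open>Each contraction pattern comes from exactly one list of modes; its entries are
    at most \<open>D\<close> and add up to \<open>D\<close>, so it occurs in
    \<open>K\<close>.\<close>
  proof (intro sum.cong refl)
    fix C \<beta> assume "C \<in> \<C>" "\<beta> \<in> bijections C {1..k}"
    then have C: "C \<subseteq> {1..s}" and \<beta>: "bij_betw \<beta> C {1..k}" by (auto simp: \<C>_def bijections_def)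
    have "(\<Sum>q=1..s. \<kappa> C \<beta> q) = (\<Sum>q\<in>C. int (t (\<beta> q)))"
      using C by (intro sum.mono_neutral_cong_right) (auto simp: \<kappa>_def)
    also have "\<dots> = D"
      unfolding D_def by (rule sum.reindex_bij_betw[OF \<beta>])
    finally have "(\<Sum>q=1..s. \<kappa> C \<beta> q) = D" .
    moreover have "\<kappa> C \<beta> q \<le> D" for q
    proof (cases "q \<in> C")
      case True
      then have "\<beta> q \<in> {1..k}" using \<beta> by (auto simp: bij_betw_def)
      then show ?thesis unfolding D_def \<kappa>_def using True by (auto intro: member_le_sum)
    qed (use \<open>D \<ge> 0\<close> in \<open>simp add: \<kappa>_def\<close>)
    ultimately have "map (\<kappa> C \<beta>) [1..<Suc s] \<in> K"
      by (auto simp: K_def relevant_modes_def list_sum simp del: upt_Suc One_nat_def)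
    moreover have "finite K"
      using \<open>D \<ge> 0\<close> by (simp add: K_def relevant_modes_def finite_bounded_above_fixed_sum)
    ultimately show "(\<Sum>ks\<in>K. if ks = map (\<kappa> C \<beta>) [1..<Suc s] then R C \<beta> else 0) = R C \<beta>"
      by (simp del: upt_Suc One_nat_def)
  qed
  also have "\<dots> = (\<Sum>c\<in>decreasing_tuples k s. \<Sum>\<beta>\<in>bijections (c ` {1..k}) {1..k}. R (c ` {1..k}) \<beta>)"
    unfolding \<C>_def by (rule sum.reindex_bij_betw[OF bij_betw_decreasing_tuples, symmetric])
  also have "\<dots> = (\<Sum>c\<in>decreasing_tuples k s. \<Sum>\<sigma> | \<sigma> permutes {1..k}.
      scaleF act
        ((\<Prod>q\<in>{1..s} - c ` {1..k}. (- 1) ^ (m q - 1))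
         * (\<Prod>q=1..k. (\<Prod>b=1..m (c q) - 1. - of_nat (t (\<sigma> q)) - of_nat b) / fact (m (c q) - 1))
         * (\<Prod>q=1..k. of_nat (t (\<sigma> q)) * l * bracket (i (c q)) (j (\<sigma> q))))
        (zero_word (map i (filter (\<lambda>q. q \<notin> c ` {1..k}) [1..<Suc s]) @ B)))"
  proof (rule sum.cong[OF refl])
    fix c assume c: "c \<in> decreasing_tuples k s"
    let ?C = "c ` {1..k}"
    note bij = decreasing_tuple_bij_betw[OF c]
    have C: "?C \<subseteq> {1..s}" using c by (auto simp: decreasing_tuples_def)
    \<comment> \<open>Reindexing the products over \<open>?C\<close> along c replaces the partner of
      c q by \<open>\<sigma> q\<close>.\<close>
    have "R ?C (restrict (\<sigma> \<circ> inv_into {1..k} c) ?C) = scaleF act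
        ((\<Prod>q\<in>{1..s} - ?C. (- 1) ^ (m q - 1))
         * (\<Prod>q=1..k. (\<Prod>b=1..m (c q) - 1. - of_nat (t (\<sigma> q)) - of_nat b) / fact (m (c q) - 1))
         * (\<Prod>q=1..k. of_nat (t (\<sigma> q)) * l * bracket (i (c q)) (j (\<sigma> q)))) (Z ?C)" for \<sigma>
    proof -
      let ?\<beta> = "restrict (\<sigma> \<circ> inv_into {1..k} c) ?C"
      have \<beta>: "?\<beta> (c q) = \<sigma> q" if "q \<in> {1..k}" for q
        using that bij by (simp add: bij_betw_def)
      have "(\<Prod>q\<in>{1..s}. dcoeff (m q) (\<kappa> ?C ?\<beta> q)) =
        (\<Prod>q\<in>{1..s} - ?C. dcoeff (m q) (\<kappa> ?C ?\<beta> q)) * (\<Prod>q\<in>?C. dcoeff (m q) (\<kappa> ?C ?\<beta> q))"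
        using C by (intro prod.subset_diff) auto
      also have "(\<Prod>q\<in>{1..s} - ?C. dcoeff (m q) (\<kappa> ?C ?\<beta> q)) = (\<Prod>q\<in>{1..s} - ?C. (- 1) ^ (m q - 1))"
        using m by (intro prod.cong) (auto simp: \<kappa>_def dcoeff_zero)
      also have "(\<Prod>q\<in>?C. dcoeff (m q) (\<kappa> ?C ?\<beta> q)) = (\<Prod>q=1..k. dcoeff (m (c q)) (\<kappa> ?C ?\<beta> (c q)))"
        by (rule prod.reindex_bij_betw[OF bij, symmetric])
      also have "\<dots> = (\<Prod>q=1..k. (\<Prod>b=1..m (c q) - 1. - of_nat (t (\<sigma> q)) - of_nat b) / fact (m (c q) - 1))"
        by (intro prod.cong refl) (simp only: \<kappa>_def imageI if_True \<beta> dcoeff_of_nat)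
      finally have dcoeffs: "(\<Prod>q\<in>{1..s}. dcoeff (m q) (\<kappa> ?C ?\<beta> q)) = (\<Prod>q\<in>{1..s} - ?C. (- 1) ^ (m q - 1)) *
        (\<Prod>q=1..k. (\<Prod>b=1..m (c q) - 1. - of_nat (t (\<sigma> q)) - of_nat b) / fact (m (c q) - 1))" .
      have "b ?C ?\<beta> = (\<Prod>q=1..k. of_nat (t (?\<beta> (c q))) * l * bracket (i (c q)) (j (?\<beta> (c q))))"
        unfolding b_def by (rule prod.reindex_bij_betw[OF bij, symmetric])
      also have "\<dots> = (\<Prod>q=1..k. of_nat (t (\<sigma> q)) * l * bracket (i (c q)) (j (\<sigma> q)))"
        by (intro prod.cong refl) (simp only: \<beta>)
      finally show ?thesis by (simp only: R_def dcoeffs)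
    qed
    then show "(\<Sum>\<beta>\<in>bijections ?C {1..k}. R ?C \<beta>) = (\<Sum>\<sigma> | \<sigma> permutes {1..k}.
      scaleF act
        ((\<Prod>q\<in>{1..s} - ?C. (- 1) ^ (m q - 1))
         * (\<Prod>q=1..k. (\<Prod>b=1..m (c q) - 1. - of_nat (t (\<sigma> q)) - of_nat b) / fact (m (c q) - 1))
         * (\<Prod>q=1..k. of_nat (t (\<sigma> q)) * l * bracket (i (c q)) (j (\<sigma> q))))
        (zero_word (map i (filter (\<lambda>q. q \<notin> ?C) [1..<Suc s]) @ B)))"
      unfolding sum_bijections_permutations[OF bij] Z_def by (intro sum.cong refl)
  qed
  finally show ?thesis .
qed

end

text \<open>Writing the null vectors as e1 + \<open>\<epsilon> i\<close> e2, the bilinear (not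
  Hermitian) pairing is 1 + \<open>\<epsilon> i * \<epsilon> j\<close>, which is 0 for equal and 2
  for opposite signs.\<close>

lemma cpairing_hvec:
  assumes "transpose G = G" "rinner G e1 e1 = 1" "rinner G e2 e2 = 1" "rinner G e1 e2 = 0"
  shows "cpairing G (hvec e1 e2 i) (hvec e1 e2 j) = bracket i j"
proof -
  let ?c = complex_of_real
  define g where "g u v = ?c (rinner G u v)" for u v
  have sym: "rinner G e2 e1 = 0"
    using assms(1,4) unfolding rinner_def
    by (metis dot_lmul_matrix inner_commute transpose_matrix_vector)
  define \<epsilon> :: "pm \<Rightarrow> complex" where "\<epsilon> i = (case i of HPlus \<Rightarrow> - \<i> | HMinus \<Rightarrow> \<i>)" for i
  have "cpairing G (hvec e1 e2 i) (hvec e1 e2 j) = g e1 e1 + \<epsilon> i * g e2 e1 + \<epsilon> j * g e1 e2 + \<epsilon> i * \<epsilon> j * g e2 e2"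
    by (cases i; cases j)
      (simp_all add: cpairing_def hvec_def g_def \<epsilon>_def rinner_def inner_vec_def matrix_vector_mult_def sum_2 algebra_simps)
  then show ?thesis
    by (cases i; cases j) (simp_all add: g_def assms sym \<epsilon>_def bracket_def)
qed

lemma decreasing_tuples_empty:
  assumes "s < k"
  shows "decreasing_tuples k s = {}"
proof -
  have False if "C \<subseteq> {1..s}" "card C = k" for C
    using card_mono[OF _ that(1)] that(2) assms by simp
  then have "(\<lambda>c. c ` {1..k}) ` decreasing_tuples k s = {}"
    unfolding bij_betw_imp_surj_on[OF bij_betw_decreasing_tuples] by blast
  then show ?thesis by (simp only: image_is_empty)
qed

theorem proposition5p3:
  fixes M :: "('m::{t2_space,second_countable_topology}) surface" and K :: real
    and c0 :: "'m chart" and p :: 'm and e1 e2 :: "real^2"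
    and U :: "'m set" and f :: "'m \<Rightarrow> complex" and l :: complex
    and act :: "TE \<Rightarrow> 's::ab_group_add \<Rightarrow> 's" and \<tau> :: "TE \<Rightarrow> ('m \<Rightarrow> complex) \<Rightarrow> 's"
    and s k r :: nat and m t :: "nat \<Rightarrow> nat" and i j :: "nat \<Rightarrow> pm"
    and H :: "pm \<Rightarrow> int \<Rightarrow> 's FS \<Rightarrow> 's FS" and F w :: "'s FS"
    and v :: "(pm \<times> nat) list \<Rightarrow>\<^sub>0 complex" and n :: int
  assumes surface: "riemannian_surface M" "connected (UNIV :: 'm set)" "complete_surface M"
      "orientable M" "constant_curvature M K" "K \<noteq> 0"
    and frame: "c0 \<in> charts M" "p \<in> fst c0" "rinner (metric M c0 p) e1 e1 = 1"
      "rinner (metric M c0 p) e2 e2 = 1" "rinner (metric M c0 p) e1 e2 = 0"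
    and U: "open U" and f: "eigenfunction M U f" and l: "l \<noteq> 0"
    and S: "tensor_over_parallel act M c0 p U \<tau>"
    and pos: "\<forall>q\<in>{1..s}. m q > 0" "\<forall>q\<in>{1..k}. t q > 0" and kr: "k \<le> r"
    and bal: "balanced (map i [1..<Suc s])" "balanced (map j [1..<Suc r])"
  defines "H \<equiv> (\<lambda>i. mode act (metric M c0 p) l (hvec e1 e2 i))"
    and "F \<equiv> Poly_Mapping.single [] (\<tau> 1 f)"
    and "v \<equiv> Poly_Mapping.single (map (\<lambda>q. (i q, m q)) [1..<Suc s]) 1"
    and "w \<equiv> foldr (\<lambda>q. H (j q) (- int (t q))) [1..<Suc k]
               (foldr (\<lambda>q. H (j q) 0) [Suc k..<Suc r] F)"
    and "n \<equiv> int (\<Sum>q=1..s. m q) + int (\<Sum>q=1..k. t q) - 1"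
  shows "v \<in> Vspace \<and> w \<in> VU act H F \<and> F \<in> VU act H F \<inter> FS_weight 0
    \<and> Ycoeff act H v n w \<in> VU act H F \<inter> FS_weight 0
    \<and> (\<forall>d. Ycoeff act H v (n - d) w \<in> VU act H F \<inter> FS_weight d)
    \<and> (\<forall>d<0. Ycoeff act H v (n - d) w = 0)
    \<and> (s < k \<longrightarrow> Ycoeff act H v n w = 0)
    \<and> (k \<le> s \<longrightarrow> Ycoeff act H v n w =
        (\<Sum>c\<in>decreasing_tuples k s. \<Sum>\<sigma> | \<sigma> permutes {1..k}.
          scaleF act
            ((\<Prod>q\<in>{1..s} - c ` {1..k}. (- 1) ^ (m q - 1))
             * (\<Prod>q=1..k. (\<Prod>b=1..m (c q) - 1. - of_nat (t (\<sigma> q)) - of_nat b) / fact (m (c q) - 1))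
             * (\<Prod>q=1..k. of_nat (t (\<sigma> q)) * l * bracket (i (c q)) (j (\<sigma> q))))
            (foldr (\<lambda>q. H (i q) 0) (filter (\<lambda>q. q \<notin> c ` {1..k}) [1..<Suc s])
              (foldr (\<lambda>q. H (j q) 0) [Suc k..<Suc r] F))))"
proof -
  have "\<forall>c\<in>charts M. \<forall>q\<in>fst c. transpose (metric M c q) = metric M c q \<and>
      (\<forall>v. v \<noteq> 0 \<longrightarrow> v \<bullet> (metric M c q *v v) > 0)"
    using surface(1) unfolding riemannian_surface_def by (elim conjE)
  then have "transpose (metric M c0 p) = metric M c0 p" using frame(1,2) by blast
  moreover have "left_module act" using S by (rule tensor_over_parallel.axioms(1))
  ultimately interpret heisenberg_modes act "metric M c0 p" l "hvec e1 e2" "\<tau> 1 f"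
    by (intro heisenberg_modes.intro TE_module.intro heisenberg_modes_axioms.intro cpairing_hvec frame)
  let ?ws = "map (\<lambda>q. (i q, m q)) [1..<Suc s]" and ?A = "map (\<lambda>q. (j q, t q)) [1..<Suc k]"
  let ?B = "map j [Suc k..<Suc r]"
  define D where "D = (\<Sum>q=1..k. int (t q))"
  have set_upt: "set [1..<Suc a] = {1..a}" for a by (simp add: atLeastLessThanSuc_atLeastAtMost del: upt_Suc)
  have list_sum: "(\<Sum>q\<leftarrow>[1..<Suc a]. g q) = (\<Sum>q=1..a. g q)" for g :: "nat \<Rightarrow> int" and a
    by (simp only: interv_sum_list_conv_sum_set_nat set_upt)
  have H: "H = h" and F: "F = vac" by (simp_all add: H_def F_def)
  have w: "w = word ?A ?B"
    by (simp add: w_def H F word_def foldr_map o_def del: upt_Suc)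
  have v: "Ycoeff act H v N u = word_coeff act h ?ws N u" for N u
    by (simp add: v_def H Ycoeff_single del: upt_Suc)
  have posA: "\<forall>x\<in>set ?A. snd x > 0" using pos(2) by (auto simp: set_upt simp del: upt_Suc)
  have "map fst ?A @ ?B = map j [1..<Suc r]"
    using upt_add_eq_append[of 1 "Suc k" "r - k"] kr by (simp add: o_def del: upt_Suc flip: map_append)
  then have balA: "balanced (map fst ?A @ ?B)" using bal(2) by simp
  have graded: "w \<in> graded_part 0 D (int k)"
    unfolding w by (rule word_in_graded_part[OF posA])
      (use balA in \<open>simp_all add: balanced_iff_charge o_def D_def list_sum del: upt_Suc One_nat_def\<close>)
  have "D \<ge> 0" by (simp add: D_def sum_nonneg)
  have balv: "balanced (map fst ?ws)" using bal(1) by (simp add: o_def del: upt_Suc)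
  \<comment> \<open>Lowering the index by d raises the weight by d, and n is the index of weight
    0.\<close>
  have weight: "D + (\<Sum>x\<leftarrow>?ws. int (snd x)) - (n - d) - 1 = d" for d
    by (simp add: n_def D_def o_def list_sum del: upt_Suc One_nat_def)
  have Y: "Ycoeff act H v (n - d) w \<in> VU act H F \<inter> FS_weight d" for d
    using word_coeff_in_VU[OF graded \<open>D \<ge> 0\<close> balv, of "n - d"] unfolding v weight by (simp only: H F)
  have "v \<in> Vspace"
    using balv pos(1) by (auto simp: v_def Vspace_def set_upt simp del: upt_Suc)
  moreover have "w \<in> VU act H F"
    unfolding w H F by (rule word_in_VU[OF posA balA])
  moreover have "F \<in> VU act H F \<inter> FS_weight 0"
    unfolding H F using subsetD[OF graded_part_VU vac_graded] subsetD[OF graded_part_FS_weight vac_graded] by blast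
  moreover have "Ycoeff act H v n w \<in> VU act H F \<inter> FS_weight 0"
    using Y[of 0] by simp
  moreover have "\<forall>d<0. Ycoeff act H v (n - d) w = 0"
    using Y FS_weight_negative by fastforce
  moreover have formula: "Ycoeff act H v n w =
        (\<Sum>c\<in>decreasing_tuples k s. \<Sum>\<sigma> | \<sigma> permutes {1..k}.
          scaleF act
            ((\<Prod>q\<in>{1..s} - c ` {1..k}. (- 1) ^ (m q - 1))
             * (\<Prod>q=1..k. (\<Prod>b=1..m (c q) - 1. - of_nat (t (\<sigma> q)) - of_nat b) / fact (m (c q) - 1))
             * (\<Prod>q=1..k. of_nat (t (\<sigma> q)) * l * bracket (i (c q)) (j (\<sigma> q))))
            (foldr (\<lambda>q. H (i q) 0) (filter (\<lambda>q. q \<notin> c ` {1..k}) [1..<Suc s])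
              (foldr (\<lambda>q. H (j q) 0) [Suc k..<Suc r] F)))"
    unfolding v w n_def word_coeff_lowest[OF pos(2,1)]
    by (simp only: H F foldr_append foldr_map o_def)
  \<comment> \<open>There is no k-element subset of an s-element set, so the vanishing is the
    formula with an empty sum.\<close>
  moreover have "Ycoeff act H v n w = 0" if "s < k"
    unfolding formula decreasing_tuples_empty[OF that] by simp
  ultimately show ?thesis using Y by blast
qed

end
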